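(* Let $\Omega=\{\mathbf a_1,\dots,\mathbf a_k\}\subseteq\mathbb F^n$ be a finite set of $k\ge1$ distinct points, $m_1,\dots,m_k\in\mathcal M$, $N:=\sum_{i=1}^k(\deg(m_i)+1)$ and $r:=1+n+\dots+n^{N-1}$. (Left version.) The following are equivalent: 1) $\Omega$ is left DP-independent of type $(m_1,\dots,m_k)$; 2) for every family $(b_{j,i})_{1\le j\le k,\,0\le i\le\deg(m_j)}$ of $N$ values in $\mathbb F$ there exists $F\in\mathcal R$ with $\deg(F)<N$ and $(\Delta_{\mathbf a_j}^{m_j^{(i)}}F)(\mathbf a_j)=b_{j,i}$ for all $j=1,\dots,k$ and $i=0,\dots,\deg(m_j)$; 3) for all $\mathbf b_j=(b_{j,0},\dots,b_{j,\deg(m_j)})\in\mathbb F^{\deg(m_j)+1}$, $j=1,\dots,k$, the linear system $$(z_1,\dots,z_r)\cdot V^{\sigma,\delta}_{(m_1,\dots,m_k)}(\mathbf a_1,\dots,\mathbf a_k)=(\mathbf b_1,\dots,\mathbf b_k)$$ has a solution $(F_1,\dots,F_r)\in\mathbb F^r$, where $V^{\sigma,\delta}_{(m_1,\dots,m_k)}(\mathbf a_1,\dots,\mathbf a_k)$ is the $r\times N$ right $(\sigma,\delta)$-confluent Vandermonde matrix of order $N$. (Right version.) Assume that $\varphi$ is an isomorphism of additive groups. The following are equivalent: 1) $\Omega$ is right DP-independent of type $(m_1,\dots,m_k)$; 2) for every family $(b_{j,i})_{1\le j\le k,\,0\le i\le\deg(m_j)}$ of $N$ values in $\mathbb F$ there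 exists $F\in\mathcal R$ with $\deg(F)<N$ and $(\Delta_{\mathbf a_j,L}^{m_j^{[i]}}F)_L(\mathbf a_j)=b_{j,i}$ for all $j=1,\dots,k$ and $i=0,\dots,\deg(m_j)$; 3) for all $\mathbf b_j=(b_{j,0},\dots,b_{j,\deg(m_j)})\in\mathbb F^{\deg(m_j)+1}$, $j=1,\dots,k$, the linear system $$V^{\sigma,\delta}_{(m_1,\dots,m_k),L}(\mathbf a_1,\dots,\mathbf a_k)\cdot{}^t(z_1,\dots,z_r)={}^t(\mathbf b_1,\dots,\mathbf b_k)$$ has a solution ${}^t(F_1,\dots,F_r)\in\mathbb F^{r\times1}$, where $V^{\sigma,\delta}_{(m_1,\dots,m_k),L}(\mathbf a_1,\dots,\mathbf a_k)$ is the $N\times r$ left $(\sigma,\delta)$-confluent Vandermonde matrix of order $N$.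
   Context: $\mathbb F$ is a division ring, $n\ge1$, $\sigma=(\sigma_{i,j}):\mathbb F\to\mathbb F^{n\times n}$ is a (unital) ring homomorphism and $\delta={}^t(\delta_1,\dots,\delta_n):\mathbb F\to\mathbb F^{n\times1}$ is a $\sigma$-vector derivation, i.e. additive with $\delta(ab)=\sigma(a)\delta(b)+\delta(a)b$. $\mathcal M$ is the free monoid on $x_1,\dots,x_n$, with empty word $o$ (identified with $1$); $\deg m$ is the word length. $\mathcal R=\mathbb F[\mathbf x;\sigma,\delta]$ is the free left $\mathbb F$-module with basis $\mathcal M$, with the ring multiplication that concatenates monomials and satisfies $x_i a=\sum_j\sigma_{i,j}(a)x_j+\delta_i(a)$ for $a\in\mathbb F$. $\deg F$ is the maximal degree of a monomial with nonzero coefficient in $F$, and $\deg 0=-\infty$. Define $\varphi:\mathbb F^n\to\mathbb F^n$ by $\varphi(\gamma_1,\dots,\gamma_n)=\big(\sum_j\sigma_{j,1}(\gamma_j),\dots,\sum_j\sigma_{j,n}(\gamma_j)\big)$. Right evaluation and derivatives: for $\mathbf a=(a_1,\dots,a_n)\in\mathbb F^n$ every $F\in\mathcal R$ is uniquely $F=\sum_i(\Delta_{\mathbf a}^{x_i}F)\,(x_i-a_i)+F(\mathbf a)$ with $\Delta_{\mathbf a}^{x_i}F\in\mathcal R$, $F(\mathbf a)\in\mathbb F$. Left ones (when $\varphi$ is bijective): every $F$ is uniquely $F=\sum_i(x_i-a_i)\,(\Delta_{\mathbf a,L}^{x_i}F)+F_L(\mathbf a)$ with $\Delta_{\mathbf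 a,L}^{x_i}F\in\mathcal R$, $F_L(\mathbf a)\in\mathbb F$. For $m=x_{i_1}\cdots x_{i_s}$: $\Delta_{\mathbf a}^mF=\Delta_{\mathbf a}^{x_{i_1}}(\Delta_{\mathbf a}^{x_{i_2}}(\cdots\Delta_{\mathbf a}^{x_{i_s}}F))$ and $\Delta_{\mathbf a,L}^mF=\Delta_{\mathbf a,L}^{x_{i_s}}(\Delta_{\mathbf a,L}^{x_{i_{s-1}}}(\cdots\Delta_{\mathbf a,L}^{x_{i_1}}F))$; $\Delta^o_{\mathbf a}F=\Delta^o_{\mathbf a,L}F=F$. $(\Delta_{\mathbf a}^mF)(\mathbf a)$ and $(\Delta_{\mathbf a,L}^mF)_L(\mathbf a)$ are the right, respectively left, evaluations at $\mathbf a$. For $m=x_{j_s}\cdots x_{j_2}x_{j_1}\in\mathcal M$ and $0\le i\le s$ write $m^{(i)}:=x_{j_i}\cdots x_{j_1}$ (suffix of length $i$) and $m^{[i]}:=x_{j_s}\cdots x_{j_{s-i+1}}$ (prefix of length $i$), with $m^{(0)}=m^{[0]}=o$. For a finite set $\Omega=\{\mathbf a_1,\dots,\mathbf a_k\}$ and $\vec m=(m_1,\dots,m_k)\in\mathcal M^k$: $I^{\vec m}(\Omega)$ is the set of $F\in\mathcal R$ with $(\Delta_{\mathbf a_j}^{m_j^{(i)}}F)(\mathbf a_j)=0$ for all $j$ and $0\le i\le\deg m_j$; $I^{\vec m}_L(\Omega)$ is the set of $F$ with $(\Delta_{\mathbf a_j,L}^{m_j^{[i]}}F)_L(\mathbf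 a_j)=0$ for all $j$ and $0\le i\le\deg m_j$. For $\Omega=\emptyset$ both are $\mathcal R$. DP-independence: for $m'\in\mathcal M$ of degree $t$, a point $\mathbf a\in\mathbb F^n\setminus\Omega$ is left DP-independent of type $(\vec m,m')$ from $\Omega$ if $I^{\vec m}(\Omega)\supsetneq I^{\vec m,m'^{(0)}}(\Omega\cup\{\mathbf a\})\supsetneq\cdots\supsetneq I^{\vec m,m'^{(t)}}(\Omega\cup\{\mathbf a\})$, and right DP-independent of type $(\vec m,m')$ from $\Omega$ if the same strict chain holds with every $I$ replaced by $I_L$ and every suffix $m'^{(i)}$ by the prefix $m'^{[i]}$. $\Omega$ is left (right) DP-independent of type $(m_1,\dots,m_k)$ if for every $j$ the point $\mathbf a_j$ is left (right) DP-independent of type $((m_1,\dots,m_{j-1},m_{j+1},\dots,m_k),m_j)$ from $\Omega\setminus\{\mathbf a_j\}$. Confluent Vandermonde matrices of order $d$: let $m'_1,\dots,m'_r$ be all monomials of $\mathcal M$ of degree $<d$, in a fixed order. $V_{m_i}^{\sigma,\delta}(\mathbf a_i)$ is the $r\times(\deg(m_i)+1)$ matrix whose $(p,q)$ entry ($1\le p\le r$, $0\le q\le\deg m_i$) is $(\Delta_{\mathbf a_i}^{m_i^{(q)}}m'_p)(\mathbf a_i)$, and $V^{\sigma,\delta}_{(m_1,\dots,m_k)}(\mathbf a_1,\dots,\mathbf a_k)=(V_{m_1}^{\sigma,\delta}(\mathbf a_1)\,|\,\cdots\,|\,V_{m_k}^{\sigma,\delta}(\mathbf a_k))$ (the right matrix).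 $V_{m_i,L}^{\sigma,\delta}(\mathbf a_i)$ is the $(\deg(m_i)+1)\times r$ matrix whose $(q,p)$ entry is $(\Delta_{\mathbf a_i,L}^{m_i^{[q]}}m'_p)_L(\mathbf a_i)$, and $V^{\sigma,\delta}_{(m_1,\dots,m_k),L}(\mathbf a_1,\dots,\mathbf a_k)$ is obtained by stacking $V_{m_1,L}^{\sigma,\delta}(\mathbf a_1),\dots,V_{m_k,L}^{\sigma,\delta}(\mathbf a_k)$ vertically (the left matrix). *)

theory Defs
  imports
    "HOL-Library.Poly_Mapping"
    "HOL-Library.Extended_Real"
    "HOL-Analysis.Finite_Cartesian_Product"
    "Jordan_Normal_Form.Matrix"
begin

text \<open>
  Both matrix libraries use the infix \<open>$\<close>; here it always denotes the component of a vector
  of type \<open>'a ^ 'n\<close>. Points, \<open>\<sigma>\<close> and \<open>\<delta>\<close> use the type-indexed vectors and matrices, whereas the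
  confluent Vandermonde matrices, whose size varies, use the matrices of \<open>Jordan_Normal_Form\<close>.
\<close>

no_notation Matrix.vec_index (infixl \<open>$\<close> 100)

definition ring_hom_mat :: "('a::division_ring \<Rightarrow> 'a ^ 'n ^ 'n) \<Rightarrow> bool" where
  "ring_hom_mat \<sigma> \<longleftrightarrow>
     Modules.additive \<sigma> \<and> (\<forall>a b. \<sigma> (a * b) = \<sigma> a ** \<sigma> b) \<and> \<sigma> 1 = Finite_Cartesian_Product.mat 1"

definition vector_derivation ::
    "('a::division_ring \<Rightarrow> 'a ^ 'n ^ 'n) \<Rightarrow> ('a \<Rightarrow> 'a ^ 'n) \<Rightarrow> bool" where
  "vector_derivation \<sigma> \<delta> \<longleftrightarrow>
     Modules.additive \<delta> \<and> (\<forall>a b. \<delta> (a * b) = \<sigma> a *v \<delta> b + (\<chi> i. \<delta> a $ i * b))"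

definition phi :: "('a::division_ring \<Rightarrow> 'a ^ 'n ^ 'n) \<Rightarrow> 'a ^ 'n \<Rightarrow> 'a ^ 'n" where
  "phi \<sigma> \<gamma> = (\<chi> i. \<Sum>j\<in>UNIV. \<sigma> (\<gamma> $ j) $ j $ i)"


section \<open>The free multivariate skew polynomial ring\<close>

text \<open>
  A monomial is a word over the finite type \<open>'n\<close> of variable indices, so \<open>n\<close> is \<open>CARD('n)\<close>. The
  additive group of the free left module is the type below. The type does not depend on \<open>\<sigma>\<close> and
  \<open>\<delta>\<close>; only the multiplication does.
\<close>

type_synonym ('a, 'n) skew_poly = "'n list \<Rightarrow>\<^sub>0 'a"

definition lscale :: "'a::division_ring \<Rightarrow> ('a, 'n) skew_poly \<Rightarrow> ('a, 'n) skew_poly" where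
  "lscale c F = Poly_Mapping.map ((*) c) F"

definition const :: "'a::division_ring \<Rightarrow> ('a, 'n) skew_poly" where
  "const c = Poly_Mapping.single [] c"

definition monomial :: "'n list \<Rightarrow> ('a::division_ring, 'n) skew_poly" where
  "monomial w = Poly_Mapping.single w 1"

definition var :: "'n \<Rightarrow> ('a::division_ring, 'n) skew_poly" where
  "var i = monomial [i]"

text \<open>\<open>deg_poly 0 = - \<infinity>\<close>\<close>
definition deg_poly :: "('a::division_ring, 'n) skew_poly \<Rightarrow> ereal" where
  "deg_poly F = (if F = 0 then - \<infinity> else ereal (real (Max (length ` Poly_Mapping.keys F))))"

text \<open>
  Left multiplication by \<open>x\<^sub>i\<close> is additive and sends \<open>c w\<close> to
  \<open>(\<Sum>\<^sub>j \<sigma>\<^sub>i\<^sub>j(c) x\<^sub>j + \<delta>\<^sub>i(c)) w\<close>; this and left linearity in the first factor force the product.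
\<close>

definition var_mult :: "('a::division_ring \<Rightarrow> 'a ^ 'n ^ 'n) \<Rightarrow> ('a \<Rightarrow> 'a ^ 'n) \<Rightarrow>
    'n::finite \<Rightarrow> ('a, 'n) skew_poly \<Rightarrow> ('a, 'n) skew_poly" where
  "var_mult \<sigma> \<delta> i F =
     (\<Sum>w\<in>Poly_Mapping.keys F.
        (\<Sum>j\<in>UNIV. Poly_Mapping.single (j # w) (\<sigma> (Poly_Mapping.lookup F w) $ i $ j))
        + Poly_Mapping.single w (\<delta> (Poly_Mapping.lookup F w) $ i))"

definition skew_mult :: "('a::division_ring \<Rightarrow> 'a ^ 'n ^ 'n) \<Rightarrow> ('a \<Rightarrow> 'a ^ 'n) \<Rightarrow>
    ('a, 'n::finite) skew_poly \<Rightarrow> ('a, 'n) skew_poly \<Rightarrow> ('a, 'n) skew_poly" where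
  "skew_mult \<sigma> \<delta> F G =
     (\<Sum>w\<in>Poly_Mapping.keys F. lscale (Poly_Mapping.lookup F w) (foldr (var_mult \<sigma> \<delta>) w G))"

text \<open>
  The characteristic laws: with \<open>skew_mult\<close> the free left module is a ring with unit \<open>const 1\<close> in
  which monomials are concatenated and \<open>x\<^sub>i a = \<Sum>\<^sub>j \<sigma>\<^sub>i\<^sub>j(a) x\<^sub>j + \<delta>\<^sub>i(a)\<close>.
\<close>

definition lin :: "('n list \<Rightarrow> 'a::zero \<Rightarrow> 'b::comm_monoid_add) \<Rightarrow> ('n list \<Rightarrow>\<^sub>0 'a) \<Rightarrow> 'b" where
  "lin f F = (\<Sum>w\<in>Poly_Mapping.keys F. f w (Poly_Mapping.lookup F w))"

lemma lin_superset:
  assumes "finite A" "Poly_Mapping.keys F \<subseteq> A" "\<And>w. f w 0 = 0"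
  shows "lin f F = (\<Sum>w\<in>A. f w (Poly_Mapping.lookup F w))"
  unfolding lin_def by (rule sum.mono_neutral_left) (use assms in \<open>auto simp: in_keys_iff\<close>)

lemma lin_add:
  fixes f :: "'n list \<Rightarrow> 'a::ab_group_add \<Rightarrow> 'b::ab_group_add"
  assumes "\<And>w. Modules.additive (f w)"
  shows "lin f (F + G) = lin f F + lin f G"
proof -
  let ?A = "Poly_Mapping.keys F \<union> Poly_Mapping.keys G"
  have 0: "\<And>w. f w 0 = 0" using assms additive.zero by blast
  have *: "lin f H = (\<Sum>w\<in>?A. f w (Poly_Mapping.lookup H w))"
    if "Poly_Mapping.keys H \<subseteq> ?A" for H
    using that by (intro lin_superset 0) auto
  show ?thesis
    by (subst (1 2 3) *)
       (auto simp: lookup_add additive.add[OF assms] sum.distrib in_keys_iff)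
qed

lemma lin_single: "f w 0 = 0 \<Longrightarrow> lin f (Poly_Mapping.single w c) = f w c"
  by (simp add: lin_def)

lemma skew_poly_additive_eqI:
  fixes A B :: "('n list \<Rightarrow>\<^sub>0 'a::ab_group_add) \<Rightarrow> 'b::ab_group_add"
  assumes "Modules.additive A" "Modules.additive B"
    and "\<And>w c. A (Poly_Mapping.single w c) = B (Poly_Mapping.single w c)"
  shows "A F = B F"
proof -
  have F: "F = (\<Sum>w\<in>Poly_Mapping.keys F. Poly_Mapping.single w (Poly_Mapping.lookup F w))"
    by (rule poly_mapping_eqI) (auto simp: lookup_sum lookup_single when_def in_keys_iff)
  show ?thesis
    by (subst (1 2) F) (simp add: additive.sum[OF assms(1)] additive.sum[OF assms(2)] assms(3))
qed

lemma lookup_lscale [simp]: "Poly_Mapping.lookup (lscale c F) w = c * Poly_Mapping.lookup F w"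
  by (auto simp: lscale_def Poly_Mapping.map.rep_eq when_def)

lemma lscale_simps [simp]:
  "lscale c (F + G) = lscale c F + lscale c G"
  "lscale (c + d) F = lscale c F + lscale d F"
  "lscale (c * d) F = lscale c (lscale d F)"
  "lscale 1 F = F" "lscale 0 F = 0" "lscale c 0 = 0"
  "lscale c (Poly_Mapping.single w d) = Poly_Mapping.single w (c * d)"
  by (auto intro!: poly_mapping_eqI simp: lookup_add lookup_single when_def algebra_simps)

lemma lscale_sum: "lscale c (\<Sum>i\<in>A. f i) = (\<Sum>i\<in>A. lscale c (f i))"
  by (induct A rule: infinite_finite_induct) auto

lemma sum_lscale: "lscale (\<Sum>i\<in>A. f i) F = (\<Sum>i\<in>A. lscale (f i) F)"
  by (induct A rule: infinite_finite_induct) auto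

context
  fixes \<sigma> :: "'a::division_ring \<Rightarrow> 'a ^ 'n::finite ^ 'n" and \<delta> :: "'a \<Rightarrow> 'a ^ 'n"
  assumes hom: "ring_hom_mat \<sigma>" and der: "vector_derivation \<sigma> \<delta>"
begin

lemma sd_add: "\<sigma> (a + b) = \<sigma> a + \<sigma> b" "\<delta> (a + b) = \<delta> a + \<delta> b"
  using hom der by (auto simp: ring_hom_mat_def vector_derivation_def Modules.additive_def)

lemma sd_0: "\<sigma> 0 = 0" "\<delta> 0 = 0"
  using sd_add(1)[of 0 0] sd_add(2)[of 0 0] by auto

lemma sd_1: "\<sigma> 1 $ i $ j = (if i = j then 1 else 0)" "\<delta> 1 = 0"
proof -
  have s: "\<sigma> 1 = Finite_Cartesian_Product.mat 1" using hom by (simp add: ring_hom_mat_def)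
  then show "\<sigma> 1 $ i $ j = (if i = j then 1 else 0)"
    by (simp add: Finite_Cartesian_Product.mat_def)
  have "\<delta> (1 * 1) = \<sigma> 1 *v \<delta> 1 + (\<chi> i. \<delta> 1 $ i * 1)"
    using der unfolding vector_derivation_def by blast
  then show "\<delta> 1 = 0" by (simp add: s)
qed

lemma sd_mult:
  "\<sigma> (a * b) $ i $ j = (\<Sum>l\<in>UNIV. \<sigma> a $ i $ l * \<sigma> b $ l $ j)"
  "\<delta> (a * b) $ i = (\<Sum>l\<in>UNIV. \<sigma> a $ i $ l * \<delta> b $ l) + \<delta> a $ i * b"
  using hom der
  by (auto simp: ring_hom_mat_def vector_derivation_def matrix_matrix_mult_def
      matrix_vector_mult_def)

lemma var_mult_lin:
  "var_mult \<sigma> \<delta> i = lin (\<lambda>w c. (\<Sum>j\<in>UNIV. Poly_Mapping.single (j # w) (\<sigma> c $ i $ j))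
                             + Poly_Mapping.single w (\<delta> c $ i))"
  by (rule ext) (simp add: var_mult_def lin_def)

lemma skew_mult_lin:
  "skew_mult \<sigma> \<delta> F G = lin (\<lambda>w c. lscale c (foldr (var_mult \<sigma> \<delta>) w G)) F"
  by (simp add: skew_mult_def lin_def)

lemma var_mult_additive: "Modules.additive (var_mult \<sigma> \<delta> i)"
  unfolding var_mult_lin
  by (rule additive.intro, rule lin_add)
     (simp add: Modules.additive_def sd_add single_add sum.distrib algebra_simps)

lemma var_mult_single:
  "var_mult \<sigma> \<delta> i (Poly_Mapping.single w c) =
     (\<Sum>j\<in>UNIV. Poly_Mapping.single (j # w) (\<sigma> c $ i $ j)) + Poly_Mapping.single w (\<delta> c $ i)"
  unfolding var_mult_lin by (subst lin_single) (simp_all add: sd_0)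

lemma foldr_var_mult_additive: "Modules.additive (foldr (var_mult \<sigma> \<delta>) w)"
  by (induct w) (simp_all add: Modules.additive_def additive.add[OF var_mult_additive])

lemma skew_mult_add_left:
  "skew_mult \<sigma> \<delta> (F + G) H = skew_mult \<sigma> \<delta> F H + skew_mult \<sigma> \<delta> G H"
  unfolding skew_mult_lin by (rule lin_add) (simp add: Modules.additive_def)

lemma skew_mult_add_right:
  "skew_mult \<sigma> \<delta> F (G + H) = skew_mult \<sigma> \<delta> F G + skew_mult \<sigma> \<delta> F H"
  by (simp add: skew_mult_def additive.add[OF foldr_var_mult_additive] sum.distrib)

lemma skew_mult_single:
  "skew_mult \<sigma> \<delta> (Poly_Mapping.single w c) G = lscale c (foldr (var_mult \<sigma> \<delta>) w G)"
  unfolding skew_mult_lin by (subst lin_single) simp_all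

lemma skew_mult_additive:
  "Modules.additive (\<lambda>F. skew_mult \<sigma> \<delta> F G)" "Modules.additive (skew_mult \<sigma> \<delta> F)"
  by (auto simp: Modules.additive_def skew_mult_add_left skew_mult_add_right)

lemma lscale_additive: "Modules.additive (lscale c :: ('a, 'n) skew_poly \<Rightarrow> _)"
  by (simp add: Modules.additive_def)

lemma skew_mult_lscale:
  "skew_mult \<sigma> \<delta> (lscale c F) G = lscale c (skew_mult \<sigma> \<delta> F G)"
  by (rule skew_poly_additive_eqI[of "\<lambda>F. skew_mult \<sigma> \<delta> (lscale c F) G"
        "\<lambda>F. lscale c (skew_mult \<sigma> \<delta> F G)"])
     (simp_all add: Modules.additive_def skew_mult_add_left skew_mult_single)

lemma skew_mult_const_left: "skew_mult \<sigma> \<delta> (const c) F = lscale c F"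
  by (simp add: const_def skew_mult_single)

lemma skew_mult_one_left: "skew_mult \<sigma> \<delta> (const 1) F = F"
  by (simp add: skew_mult_const_left)

lemma foldr_var_mult_single:
  "foldr (var_mult \<sigma> \<delta>) w (Poly_Mapping.single v 1) = Poly_Mapping.single (w @ v) 1"
proof (induct w)
  case (Cons i w)
  have "(\<Sum>j\<in>UNIV. Poly_Mapping.single (j # w @ v) (\<sigma> 1 $ i $ j))
      = (\<Sum>j\<in>UNIV. if i = j then Poly_Mapping.single (j # w @ v) (1::'a) else 0)"
    by (rule sum.cong) (auto simp: sd_1)
  with Cons show ?case by (simp add: var_mult_single sd_1)
qed simp

lemma skew_mult_one_right: "skew_mult \<sigma> \<delta> F (const 1) = F"
  by (rule skew_poly_additive_eqI[of "\<lambda>F. skew_mult \<sigma> \<delta> F (const 1)" "\<lambda>F. F"])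
     (simp_all add: Modules.additive_def skew_mult_add_left skew_mult_single const_def
       foldr_var_mult_single)

lemma skew_mult_monomial:
  "skew_mult \<sigma> \<delta> (monomial w) (monomial v) = monomial (w @ v)"
  by (simp add: monomial_def skew_mult_single foldr_var_mult_single)

lemma skew_mult_var_const:
  "skew_mult \<sigma> \<delta> (var i) (const a) =
     (\<Sum>j\<in>UNIV. lscale (\<sigma> a $ i $ j) (var j)) + const (\<delta> a $ i)"
  by (simp add: var_def monomial_def const_def skew_mult_single var_mult_single)

lemma var_mult_lscale:
  "var_mult \<sigma> \<delta> i (lscale d K) =
     (\<Sum>j\<in>UNIV. lscale (\<sigma> d $ i $ j) (var_mult \<sigma> \<delta> j K)) + lscale (\<delta> d $ i) K"
proof (rule skew_poly_additive_eqI[where F = K and A = "\<lambda>K. var_mult \<sigma> \<delta> i (lscale d K)" and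
    B = "\<lambda>K. (\<Sum>j\<in>UNIV. lscale (\<sigma> d $ i $ j) (var_mult \<sigma> \<delta> j K)) + lscale (\<delta> d $ i) K"])
  show "Modules.additive (\<lambda>K. var_mult \<sigma> \<delta> i (lscale d K))"
    by (simp add: Modules.additive_def additive.add[OF var_mult_additive])
  show "Modules.additive
     (\<lambda>K. (\<Sum>j\<in>UNIV. lscale (\<sigma> d $ i $ j) (var_mult \<sigma> \<delta> j K)) + lscale (\<delta> d $ i) K)"
    by (simp add: Modules.additive_def additive.add[OF var_mult_additive] sum.distrib algebra_simps)
next
  fix w c
  have s: "Poly_Mapping.single v (\<Sum>l\<in>UNIV. f l) = (\<Sum>l\<in>UNIV. Poly_Mapping.single v (f l))"
    for v :: "'n list" and f :: "'n \<Rightarrow> 'a"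
    by (intro poly_mapping_eqI) (simp add: lookup_sum lookup_single when_def)
  show "var_mult \<sigma> \<delta> i (lscale d (Poly_Mapping.single w c)) =
     (\<Sum>j\<in>UNIV. lscale (\<sigma> d $ i $ j) (var_mult \<sigma> \<delta> j (Poly_Mapping.single w c)))
       + lscale (\<delta> d $ i) (Poly_Mapping.single w c)"
    by (simp add: var_mult_single sd_mult s lscale_sum sum.distrib single_add add.assoc)
       (rule sum.swap)
qed

lemma skew_mult_var_mult:
  "skew_mult \<sigma> \<delta> (var_mult \<sigma> \<delta> i G) H = var_mult \<sigma> \<delta> i (skew_mult \<sigma> \<delta> G H)"
  by (rule skew_poly_additive_eqI[of "\<lambda>G. skew_mult \<sigma> \<delta> (var_mult \<sigma> \<delta> i G) H"
        "\<lambda>G. var_mult \<sigma> \<delta> i (skew_mult \<sigma> \<delta> G H)"])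
     (simp_all add: Modules.additive_def additive.add[OF var_mult_additive] skew_mult_add_left
       skew_mult_single var_mult_single var_mult_lscale additive.sum[OF skew_mult_additive(1)])

lemma skew_mult_assoc:
  "skew_mult \<sigma> \<delta> (skew_mult \<sigma> \<delta> F G) H = skew_mult \<sigma> \<delta> F (skew_mult \<sigma> \<delta> G H)"
proof -
  have w: "skew_mult \<sigma> \<delta> (foldr (var_mult \<sigma> \<delta>) w G) H
         = foldr (var_mult \<sigma> \<delta>) w (skew_mult \<sigma> \<delta> G H)" for w
    by (induct w) (simp_all add: skew_mult_var_mult)
  show ?thesis
    by (rule skew_poly_additive_eqI[of "\<lambda>F. skew_mult \<sigma> \<delta> (skew_mult \<sigma> \<delta> F G) H"
          "\<lambda>F. skew_mult \<sigma> \<delta> F (skew_mult \<sigma> \<delta> G H)"])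
       (simp_all add: Modules.additive_def skew_mult_add_left skew_mult_single skew_mult_lscale w)
qed

text \<open>
  The divisions used below to define evaluations and derivatives exist and are unique, on the left
  provided that \<open>phi \<sigma>\<close> is bijective.
\<close>

lemma skew_mult_diff:
  "skew_mult \<sigma> \<delta> F (G - H) = skew_mult \<sigma> \<delta> F G - skew_mult \<sigma> \<delta> F H"
  "skew_mult \<sigma> \<delta> (F - G) H = skew_mult \<sigma> \<delta> F H - skew_mult \<sigma> \<delta> G H"
  by (rule additive.diff[OF skew_mult_additive(2)], rule additive.diff[OF skew_mult_additive(1)])

lemma skew_mult_var_left: "skew_mult \<sigma> \<delta> (var i) F = var_mult \<sigma> \<delta> i F"
  by (simp add: var_def monomial_def skew_mult_single)

lemma const_add: "const (a + b) = const a + (const b :: ('a, 'n) skew_poly)"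
  by (simp add: const_def single_add)

lemma const_simps:
  "const (- a) = - (const a :: ('a, 'n) skew_poly)"
  "const (a - b) = const a - (const b :: ('a, 'n) skew_poly)"
  "lscale a (const b) = const (a * b)"
  "const 0 = (0 :: ('a, 'n) skew_poly)"
  by (simp_all add: const_def single_uminus single_diff)

lemma skew_mult_lscale_const: "lscale c F = skew_mult \<sigma> \<delta> (const c) F"
  by (simp add: skew_mult_const_left)

lemma single_decomp:
  "Poly_Mapping.single w c = lscale c (foldr (var_mult \<sigma> \<delta>) w (const 1))"
  by (simp add: const_def foldr_var_mult_single)

lemma poly_eq_sum_single:
  "F = (\<Sum>w\<in>Poly_Mapping.keys F. Poly_Mapping.single w (Poly_Mapping.lookup F w))"
  for F :: "('a, 'n) skew_poly"
  by (rule poly_mapping_eqI) (auto simp: lookup_sum lookup_single when_def in_keys_iff)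

lemma right_division_exists:
  "\<exists>Q c. F = (\<Sum>i\<in>UNIV. skew_mult \<sigma> \<delta> (Q i) (var i - const (a $ i))) + const c"
proof -
  let ?f = "\<lambda>Q. \<Sum>i\<in>UNIV. skew_mult \<sigma> \<delta> (Q i) (var i - const (a $ i))"
  define S where "S = {F. \<exists>Q c. F = ?f Q + const c}"
  have SI: "?f Q + const c \<in> S" for Q c by (auto simp: S_def)
  have add: "F + G \<in> S" if "F \<in> S" "G \<in> S" for F G
  proof -
    from that obtain Q c P d where "F = ?f Q + const c" "G = ?f P + const d"
      by (auto simp: S_def)
    then have "F + G = ?f (\<lambda>i. Q i + P i) + const (c + d)"
      by (simp add: skew_mult_add_left sum.distrib const_add)
    then show ?thesis using SI[of "\<lambda>i. Q i + P i" "c + d"] by (simp only:)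
  qed
  have con: "const c \<in> S" for c
    using SI[of "\<lambda>_. 0" c] by (simp add: skew_mult_def)
  have z: "0 \<in> S" using con[of 0] by (simp add: const_def)
  have sumS: "(\<Sum>x\<in>A. f x) \<in> S" if "\<And>x. f x \<in> S" for f :: "'b \<Rightarrow> _" and A
    by (induct A rule: infinite_finite_induct) (simp_all add: z add that)
  have mul: "skew_mult \<sigma> \<delta> G F \<in> S" if "F \<in> S" "\<And>c. skew_mult \<sigma> \<delta> G (const c) \<in> S" for F G
  proof -
    from that obtain Q c where F: "F = ?f Q + const c" by (auto simp: S_def)
    have "skew_mult \<sigma> \<delta> G F = ?f (\<lambda>i. skew_mult \<sigma> \<delta> G (Q i)) + skew_mult \<sigma> \<delta> G (const c)"
      by (simp add: F skew_mult_add_right additive.sum[OF skew_mult_additive(2)] skew_mult_assoc)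
    moreover have "?f (\<lambda>i. skew_mult \<sigma> \<delta> G (Q i)) \<in> S"
      using SI[of "\<lambda>i. skew_mult \<sigma> \<delta> G (Q i)" 0] by (simp add: const_def)
    ultimately show ?thesis using add that(2) by simp
  qed
  have scal: "lscale c F \<in> S" if "F \<in> S" for c F
    unfolding skew_mult_lscale_const
  proof (rule mul[OF that])
    show "skew_mult \<sigma> \<delta> (const c) (const d) \<in> S" for d
      using con[of "c * d"] by (simp add: skew_mult_const_left) (simp add: const_def)
  qed
  have var: "var k \<in> S" for k
  proof -
    have "?f (\<lambda>i. if i = k then const 1 else 0) = var k - const (a $ k)"
    proof -
      have "?f (\<lambda>i. if i = k then const 1 else 0)
          = (\<Sum>i\<in>UNIV. if i = k then var i - const (a $ i) else 0)"
        by (rule sum.cong) (auto simp: skew_mult_one_left, simp add: skew_mult_def)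
      then show ?thesis by simp
    qed
    then show ?thesis
      using SI[of "\<lambda>i. if i = k then const 1 else 0" "a $ k"] by simp
  qed
  have vm: "var_mult \<sigma> \<delta> k F \<in> S" if "F \<in> S" for k F
  proof -
    have "skew_mult \<sigma> \<delta> (var k) (const c) \<in> S" for c
      unfolding skew_mult_var_const by (intro add con sumS scal var)
    from mul[OF that this] show ?thesis by (simp add: skew_mult_var_left)
  qed
  have "foldr (var_mult \<sigma> \<delta>) w (const 1) \<in> S" for w
    by (induct w) (auto intro: con vm)
  then have "Poly_Mapping.single w c \<in> S" for w c
    unfolding single_decomp by (rule scal)
  then have "F \<in> S" by (subst poly_eq_sum_single) (rule sumS)
  then show ?thesis by (auto simp: S_def)
qed

lemma left_division_exists:
  assumes phi: "surj (phi \<sigma>)"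
  shows "\<exists>Q c. F = (\<Sum>i\<in>UNIV. skew_mult \<sigma> \<delta> (var i - const (a $ i)) (Q i)) + const c"
proof -
  let ?f = "\<lambda>Q. \<Sum>i\<in>UNIV. skew_mult \<sigma> \<delta> (var i - const (a $ i)) (Q i)"
  define S where "S = {F. \<exists>Q c. F = ?f Q + const c}"
  have SI: "?f Q + const c \<in> S" for Q c by (auto simp: S_def)
  have add: "F + G \<in> S" if "F \<in> S" "G \<in> S" for F G
  proof -
    from that obtain Q c P d where "F = ?f Q + const c" "G = ?f P + const d"
      by (auto simp: S_def)
    then have "F + G = ?f (\<lambda>i. Q i + P i) + const (c + d)"
      by (simp add: skew_mult_add_right sum.distrib const_add)
    then show ?thesis using SI[of "\<lambda>i. Q i + P i" "c + d"] by (simp only:)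
  qed
  have zr: "skew_mult \<sigma> \<delta> G 0 = 0" for G by (rule additive.zero[OF skew_mult_additive(2)])
  have con: "const c \<in> S" for c
    using SI[of "\<lambda>_. 0" c] by (simp add: zr)
  have z: "0 \<in> S" using con[of 0] by (simp add: const_def)
  have sumS: "(\<Sum>x\<in>A. f x) \<in> S" if "\<And>x. f x \<in> S" for f :: "'b \<Rightarrow> _" and A
    by (induct A rule: infinite_finite_induct) (simp_all add: z add that)
  have cv: "skew_mult \<sigma> \<delta> (const c) (var k) \<in> S" for c k
  proof -
    from phi obtain \<gamma> where \<gamma>: "phi \<sigma> \<gamma> = (\<chi> j. if j = k then c else 0)" by (metis surjD)
    have \<gamma>j: "(\<Sum>i\<in>UNIV. \<sigma> (\<gamma> $ i) $ i $ j) = (if j = k then c else 0)" for j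
      using arg_cong[OF \<gamma>, of "\<lambda>v. v $ j"] by (simp add: phi_def)
    have "(\<Sum>i\<in>UNIV. skew_mult \<sigma> \<delta> (var i) (const (\<gamma> $ i)))
        = (\<Sum>i\<in>UNIV. \<Sum>j\<in>UNIV. lscale (\<sigma> (\<gamma> $ i) $ i $ j) (var j))
          + (\<Sum>i\<in>UNIV. const (\<delta> (\<gamma> $ i) $ i))"
      by (simp add: skew_mult_var_const sum.distrib)
    also have "(\<Sum>i\<in>UNIV. \<Sum>j\<in>UNIV. lscale (\<sigma> (\<gamma> $ i) $ i $ j) (var j))
        = (\<Sum>j\<in>UNIV. lscale (\<Sum>i\<in>UNIV. \<sigma> (\<gamma> $ i) $ i $ j) (var j :: ('a, 'n) skew_poly))"
      by (subst sum.swap) (simp add: sum_lscale)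
    also have "\<dots> = (\<Sum>j\<in>UNIV. if j = k then lscale c (var j) else 0)"
      unfolding \<gamma>j by (rule sum.cong) auto
    also have "\<dots> = lscale c (var k)" by simp
    finally have "lscale c (var k) = ?f (\<lambda>i. const (\<gamma> $ i))
        + ((\<Sum>i\<in>UNIV. const (a $ i * \<gamma> $ i)) + (\<Sum>i\<in>UNIV. const (- (\<delta> (\<gamma> $ i) $ i))))"
      by (simp add: skew_mult_diff sum_subtractf skew_mult_const_left const_simps sum_negf)
    moreover have "?f (\<lambda>i. const (\<gamma> $ i)) \<in> S"
      using SI[of "\<lambda>i. const (\<gamma> $ i)" 0] by (simp add: const_def)
    moreover have "(\<Sum>i\<in>UNIV. const (a $ i * \<gamma> $ i)) + (\<Sum>i\<in>UNIV. const (- (\<delta> (\<gamma> $ i) $ i))) \<in> S"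
      by (intro add sumS con)
    ultimately show ?thesis
      unfolding skew_mult_const_left using add by (simp only:)
  qed
  have vm: "skew_mult \<sigma> \<delta> F (var k) \<in> S" if FS: "F \<in> S" for k F
  proof -
    from FS obtain Q c where F: "F = ?f Q + const c" by (auto simp: S_def)
    have "skew_mult \<sigma> \<delta> F (var k)
        = ?f (\<lambda>i. skew_mult \<sigma> \<delta> (Q i) (var k)) + skew_mult \<sigma> \<delta> (const c) (var k)"
      by (simp add: F skew_mult_add_left additive.sum[OF skew_mult_additive(1)] skew_mult_assoc)
    moreover have "?f (\<lambda>i. skew_mult \<sigma> \<delta> (Q i) (var k)) \<in> S"
      using SI[of "\<lambda>i. skew_mult \<sigma> \<delta> (Q i) (var k)" 0] by (simp add: const_def)
    ultimately show ?thesis using add cv by simp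
  qed
  have "Poly_Mapping.single w c \<in> S" for w c
  proof (induct w rule: rev_induct)
    case Nil
    show ?case using con by (simp add: const_def)
  next
    case (snoc k w)
    have "Poly_Mapping.single (w @ [k]) c = skew_mult \<sigma> \<delta> (Poly_Mapping.single w c) (var k)"
      by (simp add: var_def monomial_def skew_mult_single foldr_var_mult_single)
    with vm[OF snoc] show ?case by simp
  qed
  then have "F \<in> S" by (subst poly_eq_sum_single) (rule sumS)
  then show ?thesis by (auto simp: S_def)
qed

lemma lookup_var_mult_Cons:
  "Poly_Mapping.lookup (var_mult \<sigma> \<delta> i F) (j # w)
     = \<sigma> (Poly_Mapping.lookup F w) $ i $ j + \<delta> (Poly_Mapping.lookup F (j # w)) $ i"
proof (rule skew_poly_additive_eqI[where F = F
      and A = "\<lambda>F. Poly_Mapping.lookup (var_mult \<sigma> \<delta> i F) (j # w)"])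
  fix v c
  have "(\<Sum>l\<in>UNIV. Poly_Mapping.lookup (Poly_Mapping.single (l # v) (\<sigma> c $ i $ l)) (j # w))
      = (\<Sum>l\<in>UNIV. if l = j then if v = w then \<sigma> c $ i $ l else 0 else 0)"
    by (rule sum.cong) (auto simp: lookup_single when_def)
  then show "Poly_Mapping.lookup (var_mult \<sigma> \<delta> i (Poly_Mapping.single v c)) (j # w)
     = \<sigma> (Poly_Mapping.lookup (Poly_Mapping.single v c) w) $ i $ j
       + \<delta> (Poly_Mapping.lookup (Poly_Mapping.single v c) (j # w)) $ i"
    by (auto simp: var_mult_single lookup_add lookup_sum lookup_single when_def sd_0)
qed (simp_all add: Modules.additive_def additive.add[OF var_mult_additive] lookup_add sd_add)

lemma lookup_skew_mult_var:
  "Poly_Mapping.lookup (skew_mult \<sigma> \<delta> F (var i)) (w @ [j])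
     = (if i = j then Poly_Mapping.lookup F w else 0)"
  by (rule skew_poly_additive_eqI[where F = F
      and A = "\<lambda>F. Poly_Mapping.lookup (skew_mult \<sigma> \<delta> F (var i)) (w @ [j])"
      and B = "\<lambda>F. if i = j then Poly_Mapping.lookup F w else 0"])
    (auto simp: Modules.additive_def skew_mult_add_left lookup_add skew_mult_single var_def
      monomial_def foldr_var_mult_single lookup_single when_def)

lemma lookup_var_mult_long:
  assumes "\<And>u. length u > d \<Longrightarrow> Poly_Mapping.lookup F u = 0" "length u > Suc d"
  shows "Poly_Mapping.lookup (var_mult \<sigma> \<delta> i F) u = 0"
  using assms by (cases u) (auto simp: lookup_var_mult_Cons sd_0)

lemma lookup_skew_mult_const_long:
  assumes "\<And>v. v \<in> Poly_Mapping.keys F \<Longrightarrow> length v < length u"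
  shows "Poly_Mapping.lookup (skew_mult \<sigma> \<delta> F (const c)) u = 0"
proof -
  have "Poly_Mapping.lookup (foldr (var_mult \<sigma> \<delta>) v (const c)) u = 0" if "length u > length v"
    for u v
    using that
  proof (induct v arbitrary: u)
    case Nil
    then show ?case by (auto simp: const_def lookup_single when_def)
  next
    case (Cons i v)
    show ?case using lookup_var_mult_long[OF Cons(1)] Cons(2) by simp
  qed
  with assms show ?thesis by (simp add: skew_mult_def lookup_sum)
qed

lemma top_degree_word:
  fixes Q :: "'n \<Rightarrow> ('a, 'n) skew_poly"
  assumes "Q k \<noteq> 0"
  obtains w l where "w \<in> Poly_Mapping.keys (Q l)"
    "\<And>i v. v \<in> Poly_Mapping.keys (Q i) \<Longrightarrow> length v \<le> length w"
proof -
  let ?K = "\<Union>i. Poly_Mapping.keys (Q i)"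
  have fin: "finite ?K" by auto
  have ne: "?K \<noteq> {}" using assms by (auto simp: UNION_empty_conv)
  have "Max (length ` ?K) \<in> length ` ?K" using fin ne by (intro Max_in) auto
  then obtain w where w: "w \<in> ?K" "length w = Max (length ` ?K)" by force
  have "length v \<le> length w" if "v \<in> Poly_Mapping.keys (Q i)" for i v
    unfolding w(2) using that fin by (intro Max_ge) auto
  with w(1) that show ?thesis by blast
qed

lemma right_division_zero:
  assumes "(\<Sum>i\<in>UNIV. skew_mult \<sigma> \<delta> (Q i) (var i - const (a $ i))) + const c = 0"
  shows "Q = (\<lambda>_. 0) \<and> c = 0"
proof -
  have Q: "Q k = 0" for k
  proof (rule ccontr)
    assume "Q k \<noteq> 0"
    then obtain w l where w: "w \<in> Poly_Mapping.keys (Q l)"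
      "\<And>i v. v \<in> Poly_Mapping.keys (Q i) \<Longrightarrow> length v \<le> length w"
      using top_degree_word by blast
    have 0: "Poly_Mapping.lookup (skew_mult \<sigma> \<delta> (Q i) (const d)) (w @ [l]) = 0" for i d
      by (rule lookup_skew_mult_const_long) (use w(2) in fastforce)
    have "0 = Poly_Mapping.lookup
        ((\<Sum>i\<in>UNIV. skew_mult \<sigma> \<delta> (Q i) (var i - const (a $ i))) + const c) (w @ [l])"
      by (simp add: assms)
    also have "\<dots> = (\<Sum>i\<in>UNIV. if i = l then Poly_Mapping.lookup (Q i) w else 0)"
      by (simp add: lookup_add lookup_sum skew_mult_diff lookup_minus lookup_skew_mult_var 0)
         (simp add: const_def lookup_single)
    also have "\<dots> = Poly_Mapping.lookup (Q l) w" by simp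
    finally show False using w(1) by (simp add: in_keys_iff)
  qed
  then have "const c = (0 :: ('a, 'n) skew_poly)" using assms by (simp add: skew_mult_def)
  then have "c = 0" by (metis const_def lookup_single_eq lookup_zero)
  with Q show ?thesis by auto
qed

lemma left_division_zero:
  assumes phi: "inj (phi \<sigma>)"
    and eq: "(\<Sum>i\<in>UNIV. skew_mult \<sigma> \<delta> (var i - const (a $ i)) (Q i)) + const c = 0"
  shows "Q = (\<lambda>_. 0) \<and> c = 0"
proof -
  have Q: "Q k = 0" for k
  proof (rule ccontr)
    assume "Q k \<noteq> 0"
    then obtain w l where w: "w \<in> Poly_Mapping.keys (Q l)"
      "\<And>i v. v \<in> Poly_Mapping.keys (Q i) \<Longrightarrow> length v \<le> length w"
      using top_degree_word by blast
    have 0: "Poly_Mapping.lookup (Q i) (j # w) = 0" for i j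
      using w(2)[of "j # w" i] by (auto simp: in_keys_iff)
    have "(\<Sum>i\<in>UNIV. \<sigma> (Poly_Mapping.lookup (Q i) w) $ i $ j) = 0" for j
    proof -
      have "0 = Poly_Mapping.lookup
        ((\<Sum>i\<in>UNIV. skew_mult \<sigma> \<delta> (var i - const (a $ i)) (Q i)) + const c) (j # w)"
        by (simp add: eq)
      also have "\<dots> = (\<Sum>i\<in>UNIV. \<sigma> (Poly_Mapping.lookup (Q i) w) $ i $ j)"
        by (simp add: lookup_add lookup_sum skew_mult_diff lookup_minus skew_mult_var_left
            skew_mult_const_left lookup_var_mult_Cons 0 sd_0) (simp add: const_def lookup_single)
      finally show ?thesis by simp
    qed
    then have "phi \<sigma> (\<chi> i. Poly_Mapping.lookup (Q i) w) = phi \<sigma> 0"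
      by (simp add: phi_def sd_0)
    from arg_cong[OF injD[OF phi this], of "\<lambda>v. v $ l"]
    have "Poly_Mapping.lookup (Q l) w = 0" by simp
    with w(1) show False by (simp add: in_keys_iff)
  qed
  then have "const c = (0 :: ('a, 'n) skew_poly)"
    using eq by (simp add: additive.zero[OF skew_mult_additive(2)])
  then have "c = 0" by (metis const_def lookup_single_eq lookup_zero)
  with Q show ?thesis by auto
qed

lemma right_division_unique:
  "\<exists>!(Q, c). F = (\<Sum>i\<in>UNIV. skew_mult \<sigma> \<delta> (Q i) (var i - const (a $ i))) + const c"
proof -
  let ?f = "\<lambda>Q. \<Sum>i\<in>UNIV. skew_mult \<sigma> \<delta> (Q i) (var i - const (a $ i))"
  have uniq: "Q = P \<and> c = d" if "?f Q + const c = ?f P + const d" for Q P c d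
  proof -
    have "?f (\<lambda>i. Q i - P i) + const (c - d) = 0"
      using that by (simp add: skew_mult_diff(2) sum_subtractf const_def single_diff algebra_simps)
    from right_division_zero[OF this] show ?thesis by (auto simp: fun_eq_iff)
  qed
  obtain P d where P: "F = ?f P + const d" using right_division_exists[of F a] by blast
  show ?thesis
  proof (rule ex1I[of _ "(P, d)"])
    show "case (P, d) of (Q, c) \<Rightarrow> F = ?f Q + const c" using P by simp
    fix y assume y: "case y of (Q, c) \<Rightarrow> F = ?f Q + const c"
    obtain Q c where Qc: "y = (Q, c)" by (cases y)
    have "?f Q + const c = ?f P + const d" using y P unfolding Qc by (simp only: prod.case)
    then show "y = (P, d)" using uniq unfolding Qc by blast
  qed
qed

lemma left_division_unique:
  assumes phi: "bij (phi \<sigma>)"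
  shows "\<exists>!(Q, c). F = (\<Sum>i\<in>UNIV. skew_mult \<sigma> \<delta> (var i - const (a $ i)) (Q i)) + const c"
proof -
  let ?f = "\<lambda>Q. \<Sum>i\<in>UNIV. skew_mult \<sigma> \<delta> (var i - const (a $ i)) (Q i)"
  have uniq: "Q = P \<and> c = d" if "?f Q + const c = ?f P + const d" for Q P c d
  proof -
    have "?f (\<lambda>i. Q i - P i) + const (c - d) = 0"
      using that by (simp add: skew_mult_diff(1) sum_subtractf const_def single_diff algebra_simps)
    from left_division_zero[OF bij_is_inj[OF phi] this] show ?thesis by (auto simp: fun_eq_iff)
  qed
  obtain P d where P: "F = ?f P + const d" using left_division_exists[OF bij_is_surj[OF phi], of F a] by blast
  show ?thesis
  proof (rule ex1I[of _ "(P, d)"])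
    show "case (P, d) of (Q, c) \<Rightarrow> F = ?f Q + const c" using P by simp
    fix y assume y: "case y of (Q, c) \<Rightarrow> F = ?f Q + const c"
    obtain Q c where Qc: "y = (Q, c)" by (cases y)
    have "?f Q + const c = ?f P + const d" using y P unfolding Qc by (simp only: prod.case)
    then show "y = (P, d)" using uniq unfolding Qc by blast
  qed
qed

end


section \<open>Evaluations and derivatives\<close>

definition right_div :: "('a::division_ring \<Rightarrow> 'a ^ 'n ^ 'n) \<Rightarrow> ('a \<Rightarrow> 'a ^ 'n) \<Rightarrow> 'a ^ 'n \<Rightarrow>
    ('a, 'n::finite) skew_poly \<Rightarrow> ('n \<Rightarrow> ('a, 'n) skew_poly) \<times> 'a" where
  "right_div \<sigma> \<delta> a F =
     (THE (Q, c). F = (\<Sum>i\<in>UNIV. skew_mult \<sigma> \<delta> (Q i) (var i - const (a $ i))) + const c)"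

definition reval :: "('a::division_ring \<Rightarrow> 'a ^ 'n ^ 'n) \<Rightarrow> ('a \<Rightarrow> 'a ^ 'n) \<Rightarrow> 'a ^ 'n \<Rightarrow>
    ('a, 'n::finite) skew_poly \<Rightarrow> 'a" where
  "reval \<sigma> \<delta> a F = snd (right_div \<sigma> \<delta> a F)"

definition rderiv :: "('a::division_ring \<Rightarrow> 'a ^ 'n ^ 'n) \<Rightarrow> ('a \<Rightarrow> 'a ^ 'n) \<Rightarrow> 'a ^ 'n \<Rightarrow>
    'n list \<Rightarrow> ('a, 'n::finite) skew_poly \<Rightarrow> ('a, 'n) skew_poly" where
  "rderiv \<sigma> \<delta> a m F = foldr (\<lambda>i G. fst (right_div \<sigma> \<delta> a G) i) m F"

text \<open>The left versions are meaningful only if \<open>phi \<sigma>\<close> is bijective.\<close>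

definition left_div :: "('a::division_ring \<Rightarrow> 'a ^ 'n ^ 'n) \<Rightarrow> ('a \<Rightarrow> 'a ^ 'n) \<Rightarrow> 'a ^ 'n \<Rightarrow>
    ('a, 'n::finite) skew_poly \<Rightarrow> ('n \<Rightarrow> ('a, 'n) skew_poly) \<times> 'a" where
  "left_div \<sigma> \<delta> a F =
     (THE (Q, c). F = (\<Sum>i\<in>UNIV. skew_mult \<sigma> \<delta> (var i - const (a $ i)) (Q i)) + const c)"

definition leval :: "('a::division_ring \<Rightarrow> 'a ^ 'n ^ 'n) \<Rightarrow> ('a \<Rightarrow> 'a ^ 'n) \<Rightarrow> 'a ^ 'n \<Rightarrow>
    ('a, 'n::finite) skew_poly \<Rightarrow> 'a" where
  "leval \<sigma> \<delta> a F = snd (left_div \<sigma> \<delta> a F)"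

text \<open>The right derivative applies the last letter of the word first, the left one the first letter.\<close>

definition lderiv :: "('a::division_ring \<Rightarrow> 'a ^ 'n ^ 'n) \<Rightarrow> ('a \<Rightarrow> 'a ^ 'n) \<Rightarrow> 'a ^ 'n \<Rightarrow>
    'n list \<Rightarrow> ('a, 'n::finite) skew_poly \<Rightarrow> ('a, 'n) skew_poly" where
  "lderiv \<sigma> \<delta> a m F = fold (\<lambda>i G. fst (left_div \<sigma> \<delta> a G) i) m F"

text \<open>The suffix \<open>m\<^sup>(\<^sup>i\<^sup>)\<close>; the prefix \<open>m\<^sup>[\<^sup>i\<^sup>]\<close> is \<open>take i m\<close>.\<close>
definition suffix_of_len :: "nat \<Rightarrow> 'n list \<Rightarrow> 'n list" where
  "suffix_of_len i m = drop (length m - i) m"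


section \<open>DP-independence\<close>

text \<open>
  A finite set of points with its type is a pair of lists \<open>pts\<close>, \<open>ms\<close> of equal length, \<open>ms ! j\<close>
  being attached to \<open>pts ! j\<close>; adjoining a point appends to both. The vanishing sets are named after
  the side of the evaluation: \<open>right_van\<close> is \<open>I\<close> and governs left DP-independence, \<open>left_van\<close> is
  \<open>I\<^sub>L\<close> and governs right DP-independence.
\<close>

definition right_van :: "('a::division_ring \<Rightarrow> 'a ^ 'n ^ 'n) \<Rightarrow> ('a \<Rightarrow> 'a ^ 'n) \<Rightarrow>
    ('a ^ 'n) list \<Rightarrow> 'n::finite list list \<Rightarrow> ('a, 'n) skew_poly set" where
  "right_van \<sigma> \<delta> pts ms =
     {F. \<forall>j < length pts. \<forall>i \<le> length (ms ! j).
           reval \<sigma> \<delta> (pts ! j) (rderiv \<sigma> \<delta> (pts ! j) (suffix_of_len i (ms ! j)) F) = 0}"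

definition left_van :: "('a::division_ring \<Rightarrow> 'a ^ 'n ^ 'n) \<Rightarrow> ('a \<Rightarrow> 'a ^ 'n) \<Rightarrow>
    ('a ^ 'n) list \<Rightarrow> 'n::finite list list \<Rightarrow> ('a, 'n) skew_poly set" where
  "left_van \<sigma> \<delta> pts ms =
     {F. \<forall>j < length pts. \<forall>i \<le> length (ms ! j).
           leval \<sigma> \<delta> (pts ! j) (lderiv \<sigma> \<delta> (pts ! j) (take i (ms ! j)) F) = 0}"

definition left_DP_indep_point :: "('a::division_ring \<Rightarrow> 'a ^ 'n ^ 'n) \<Rightarrow> ('a \<Rightarrow> 'a ^ 'n) \<Rightarrow>
    ('a ^ 'n) list \<Rightarrow> 'n::finite list list \<Rightarrow> 'a ^ 'n \<Rightarrow> 'n list \<Rightarrow> bool" where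
  "left_DP_indep_point \<sigma> \<delta> pts ms a m \<longleftrightarrow>
     a \<notin> set pts \<and>
     right_van \<sigma> \<delta> (pts @ [a]) (ms @ [suffix_of_len 0 m]) \<subset> right_van \<sigma> \<delta> pts ms \<and>
     (\<forall>i < length m. right_van \<sigma> \<delta> (pts @ [a]) (ms @ [suffix_of_len (Suc i) m])
                       \<subset> right_van \<sigma> \<delta> (pts @ [a]) (ms @ [suffix_of_len i m]))"

definition right_DP_indep_point :: "('a::division_ring \<Rightarrow> 'a ^ 'n ^ 'n) \<Rightarrow> ('a \<Rightarrow> 'a ^ 'n) \<Rightarrow>
    ('a ^ 'n) list \<Rightarrow> 'n::finite list list \<Rightarrow> 'a ^ 'n \<Rightarrow> 'n list \<Rightarrow> bool" where
  "right_DP_indep_point \<sigma> \<delta> pts ms a m \<longleftrightarrow>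
     a \<notin> set pts \<and>
     left_van \<sigma> \<delta> (pts @ [a]) (ms @ [take 0 m]) \<subset> left_van \<sigma> \<delta> pts ms \<and>
     (\<forall>i < length m. left_van \<sigma> \<delta> (pts @ [a]) (ms @ [take (Suc i) m])
                       \<subset> left_van \<sigma> \<delta> (pts @ [a]) (ms @ [take i m]))"

definition remove_nth :: "nat \<Rightarrow> 'b list \<Rightarrow> 'b list" where
  "remove_nth j xs = take j xs @ drop (Suc j) xs"

definition left_DP_indep :: "('a::division_ring \<Rightarrow> 'a ^ 'n ^ 'n) \<Rightarrow> ('a \<Rightarrow> 'a ^ 'n) \<Rightarrow>
    ('a ^ 'n) list \<Rightarrow> 'n::finite list list \<Rightarrow> bool" where
  "left_DP_indep \<sigma> \<delta> pts ms \<longleftrightarrow>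
     (\<forall>j < length pts.
        left_DP_indep_point \<sigma> \<delta> (remove_nth j pts) (remove_nth j ms) (pts ! j) (ms ! j))"

definition right_DP_indep :: "('a::division_ring \<Rightarrow> 'a ^ 'n ^ 'n) \<Rightarrow> ('a \<Rightarrow> 'a ^ 'n) \<Rightarrow>
    ('a ^ 'n) list \<Rightarrow> 'n::finite list list \<Rightarrow> bool" where
  "right_DP_indep \<sigma> \<delta> pts ms \<longleftrightarrow>
     (\<forall>j < length pts.
        right_DP_indep_point \<sigma> \<delta> (remove_nth j pts) (remove_nth j ms) (pts ! j) (ms ! j))"


section \<open>Confluent Vandermonde matrices\<close>

text \<open>A fixed order on the monomials of degree less than \<open>d\<close>.\<close>
definition lists_monomials :: "nat \<Rightarrow> 'n list list \<Rightarrow> bool" where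
  "lists_monomials d mons \<longleftrightarrow> distinct mons \<and> set mons = {w. length w < d}"

definition right_Vandermonde_block :: "('a::division_ring \<Rightarrow> 'a ^ 'n ^ 'n) \<Rightarrow> ('a \<Rightarrow> 'a ^ 'n) \<Rightarrow>
    'n::finite list list \<Rightarrow> 'a ^ 'n \<Rightarrow> 'n list \<Rightarrow> 'a Matrix.mat" where
  "right_Vandermonde_block \<sigma> \<delta> mons a m =
     Matrix.mat (length mons) (length m + 1)
       (\<lambda>(p, q). reval \<sigma> \<delta> a (rderiv \<sigma> \<delta> a (suffix_of_len q m) (monomial (mons ! p))))"

definition right_Vandermonde :: "('a::division_ring \<Rightarrow> 'a ^ 'n ^ 'n) \<Rightarrow> ('a \<Rightarrow> 'a ^ 'n) \<Rightarrow>
    'n::finite list list \<Rightarrow> ('a ^ 'n) list \<Rightarrow> 'n list list \<Rightarrow> 'a Matrix.mat" where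
  "right_Vandermonde \<sigma> \<delta> mons pts ms =
     mat_of_cols (length mons)
       (concat (map2 (\<lambda>a m. cols (right_Vandermonde_block \<sigma> \<delta> mons a m)) pts ms))"

definition left_Vandermonde_block :: "('a::division_ring \<Rightarrow> 'a ^ 'n ^ 'n) \<Rightarrow> ('a \<Rightarrow> 'a ^ 'n) \<Rightarrow>
    'n::finite list list \<Rightarrow> 'a ^ 'n \<Rightarrow> 'n list \<Rightarrow> 'a Matrix.mat" where
  "left_Vandermonde_block \<sigma> \<delta> mons a m =
     Matrix.mat (length m + 1) (length mons)
       (\<lambda>(q, p). leval \<sigma> \<delta> a (lderiv \<sigma> \<delta> a (take q m) (monomial (mons ! p))))"

definition left_Vandermonde :: "('a::division_ring \<Rightarrow> 'a ^ 'n ^ 'n) \<Rightarrow> ('a \<Rightarrow> 'a ^ 'n) \<Rightarrow>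
    'n::finite list list \<Rightarrow> ('a ^ 'n) list \<Rightarrow> 'n list list \<Rightarrow> 'a Matrix.mat" where
  "left_Vandermonde \<sigma> \<delta> mons pts ms =
     mat_of_rows (length mons)
       (concat (map2 (\<lambda>a m. rows (left_Vandermonde_block \<sigma> \<delta> mons a m)) pts ms))"

definition concat_vec :: "'a Matrix.vec list \<Rightarrow> 'a Matrix.vec" where
  "concat_vec bs = vec_of_list (concat (map list_of_vec bs))"

end

theory Submission
  imports Defs
begin

text \<open>
  Fix the points and words, and consider the \<open>N\<close> functionals that send a polynomial to the values of
  its derivatives occurring in the problem. They are left linear in the case of right evaluations,
  and right linear in the case of left evaluations.

  A step of a chain in the definition of DP-independence is strict exactly if some polynomial
  satisfies the earlier conditions of the chain and violates the new one. So DP-independence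
  provides, for every functional, a polynomial on which it is nonzero while all functionals at the
  other points and all those of lower order at the same point are zero
  (\<open>strict_chain_iff_triangular\<close>). Ordering the functionals by points and then by orders makes this
  a triangular system, which yields interpolation by polynomials of some degree; conversely,
  interpolating the unit vectors gives such polynomials.

  The bound \<open>deg F < N\<close> comes from a dimension count. Since the derivatives are taken along all
  suffixes, respectively prefixes, of a word, the common kernel of the functionals is a left,
  respectively right, ideal (\<open>reval_rderiv_mult\<close>, \<open>leval_lderiv_mult\<close>). Therefore the spaces of
  values taken by polynomials of degree less than \<open>d\<close> form an increasing chain in \<open>d\<close> which is
  constant from its first repetition on. In an \<open>N\<close>-dimensional space such a chain has reached its
  union after \<open>N\<close> steps (\<open>chain_of_subspaces_full\<close>, \<open>interpolation_in_bounded_degree\<close>).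

  Finally, the linear systems express the same interpolation problem in the coefficients of \<open>F\<close>. For
  left evaluations these are coefficients to the right of the monomials, and surjectivity of
  \<open>phi \<sigma>\<close> is what lets every polynomial of degree less than \<open>N\<close> be written in this way without
  raising the degree (\<open>polys_less_right_coefficients\<close>).
\<close>


section \<open>Subspaces of a finite power of a division ring\<close>

definition tuples :: "nat \<Rightarrow> (nat \<Rightarrow> 'a::zero) set" where
  "tuples N = {v. \<forall>p\<ge>N. v p = 0}"

text \<open>
  Left and right subspaces are treated together: instead of a scalar action only its effect is
  required, that a nonzero coordinate can be given any value while zero coordinates remain zero.
\<close>

definition one_sided_subspace :: "(nat \<Rightarrow> 'a::ab_group_add) set \<Rightarrow> bool" where
  "one_sided_subspace V \<longleftrightarrow> (\<lambda>_. 0) \<in> V \<and> (\<forall>u\<in>V. \<forall>v\<in>V. (\<lambda>p. u p - v p) \<in> V) \<and>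
     (\<forall>u\<in>V. \<forall>p c. u p \<noteq> 0 \<longrightarrow> (\<exists>u'\<in>V. u' p = c \<and> (\<forall>q. u q = 0 \<longrightarrow> u' q = 0)))"

text \<open>
  The pivot positions of a matrix in echelon form whose rows span \<open>V\<close>. Their number is the dimension
  of \<open>V\<close>, and counting them replaces the dimension theory of vector spaces over a division ring.
\<close>

definition pivots :: "(nat \<Rightarrow> 'a::zero) set \<Rightarrow> nat set" where
  "pivots V = {p. \<exists>u\<in>V. u p \<noteq> 0 \<and> (\<forall>q<p. u q = 0)}"

lemma pivots_mono: "U \<subseteq> V \<Longrightarrow> pivots U \<subseteq> pivots V"
  by (auto simp: pivots_def)

lemma pivots_tuples: "V \<subseteq> tuples N \<Longrightarrow> pivots V \<subseteq> {..<N}"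
  by (fastforce simp: pivots_def tuples_def not_less[symmetric])

lemma one_sided_subspace_tuples: "one_sided_subspace (tuples N :: (nat \<Rightarrow> 'a::ab_group_add) set)"
proof -
  have "\<exists>u'\<in>tuples N. u' p = c \<and> (\<forall>q. u q = 0 \<longrightarrow> u' q = 0)"
    if "u \<in> tuples N" "u p \<noteq> 0" for u :: "nat \<Rightarrow> 'a" and p c
    by (rule bexI[of _ "\<lambda>q. if q = p then c else 0"]) (use that in \<open>auto simp: tuples_def\<close>)
  then show ?thesis by (auto simp: one_sided_subspace_def tuples_def)
qed

text \<open>Elimination: subtracting elements of \<open>U\<close> clears the coordinates of \<open>v\<close> from the left.\<close>

lemma subspace_eq_if_pivots_subset:
  fixes U V :: "(nat \<Rightarrow> 'a::ab_group_add) set"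
  assumes U: "one_sided_subspace U" and V: "one_sided_subspace V"
    and sub: "U \<subseteq> V" "V \<subseteq> tuples N" and piv: "pivots V \<subseteq> pivots U"
  shows "U = V"
proof -
  have "v \<in> U" if "v \<in> V" "\<forall>q<p. v q = 0" "N - p = n" for v p n
    using that
  proof (induct n arbitrary: v p)
    case 0
    then have "v q = 0" for q using sub(2) by (cases "q < p") (auto simp: tuples_def)
    then have "v = (\<lambda>_. 0)" by blast
    then show ?case using U by (simp add: one_sided_subspace_def)
  next
    case (Suc n)
    \<comment> \<open>an element of \<open>U\<close> that clears coordinate \<open>p\<close> of \<open>v\<close> without disturbing the earlier ones\<close>
    obtain u where u: "u \<in> U" "u p = v p" "\<forall>q<p. u q = 0"
    proof (cases "v p = 0")
      case True
      then show ?thesis using U that[of "\<lambda>_. 0"] by (simp add: one_sided_subspace_def)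
    next
      case False
      then have "p \<in> pivots U" using piv Suc.prems by (auto simp: pivots_def)
      then obtain w where "w \<in> U" "w p \<noteq> 0" "\<forall>q<p. w q = 0" by (auto simp: pivots_def)
      moreover from this U obtain u where "u \<in> U" "u p = v p" "\<forall>q. w q = 0 \<longrightarrow> u q = 0"
        unfolding one_sided_subspace_def by blast
      ultimately show ?thesis using that by blast
    qed
    have "(\<lambda>q. v q - u q) \<in> U"
    proof (rule Suc.hyps)
      show "(\<lambda>q. v q - u q) \<in> V" using V sub(1) u(1) Suc.prems(1)
        by (auto simp: one_sided_subspace_def)
      show "\<forall>q<Suc p. v q - u q = 0" using u Suc.prems(2) by (simp add: less_Suc_eq)
      show "N - Suc p = n" using Suc.prems(3) by simp
    qed
    moreover have "(\<lambda>q. x q - y q) \<in> U" if "x \<in> U" "y \<in> U" for x y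
      using U that by (simp add: one_sided_subspace_def)
    moreover have "(\<lambda>_. 0) \<in> U" using U by (simp add: one_sided_subspace_def)
    ultimately have "(\<lambda>q. (v q - u q) - (0 - u q)) \<in> U" using u(1) by presburger
    then show ?case by simp
  qed
  from this[of _ 0] sub(1) show ?thesis by auto
qed

text \<open>
  As long as the chain grows, every step contributes a new pivot, and there are only \<open>N\<close> of them;
  once the chain pauses it is constant. In both cases no pivot appears after step \<open>N\<close>.
\<close>

lemma chain_of_subspaces_full:
  fixes V :: "nat \<Rightarrow> (nat \<Rightarrow> 'a::ab_group_add) set"
  assumes sub: "\<And>d. one_sided_subspace (V d)" "\<And>d. V d \<subseteq> tuples N"
    and mono: "\<And>d. V d \<subseteq> V (Suc d)"
    and stable: "\<And>d. V d = V (Suc d) \<Longrightarrow> V (Suc d) = V (Suc (Suc d))"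
    and full: "{..<N} \<subseteq> (\<Union>d. pivots (V d))"
  shows "V N = tuples N"
proof -
  have le: "V d \<subseteq> V e" if "d \<le> e" for d e using lift_Suc_mono_le[of V, OF mono that] .
  have "{..<N} \<subseteq> pivots (V N)"
  proof (cases "\<exists>d<N. V d = V (Suc d)")
    case True
    then obtain d where d: "d < N" "V d = V (Suc d)" by blast
    have "V (d + e) = V (Suc (d + e))" for e
      by (induct e) (use d(2) stable in auto)
    then have "V (d + e) = V d" for e by (induct e) auto
    then have "V e \<subseteq> V N" for e
      using le[of e "d + e"] le[of d N] d(1) by auto
    then have "pivots (V e) \<subseteq> pivots (V N)" for e by (rule pivots_mono)
    then show ?thesis using full by blast
  next
    case False
    have "d \<le> card (pivots (V d))" if "d \<le> N" for d
      using that
    proof (induct d)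
      case (Suc d)
      have "V d \<noteq> V (Suc d)" using False Suc.prems by auto
      then have "\<not> pivots (V (Suc d)) \<subseteq> pivots (V d)"
        using subspace_eq_if_pivots_subset[OF sub(1) sub(1) mono sub(2)] by blast
      then have "card (pivots (V d)) < card (pivots (V (Suc d)))"
        using pivots_mono[OF mono, of d] pivots_tuples[OF sub(2), of "Suc d"]
        by (intro psubset_card_mono) (auto intro: finite_subset)
      then show ?case using Suc by simp
    qed simp
    \<comment> \<open>\<open>N\<close> proper inclusions give at least \<open>N\<close> pivots, and there are no others than \<open>{..<N}\<close>.\<close>
    then have "card {..<N} \<le> card (pivots (V N))" by simp
    then show ?thesis
      using card_seteq[OF _ pivots_tuples[OF sub(2), of N]] by simp
  qed
  then have "pivots (tuples N :: (nat \<Rightarrow> 'a) set) \<subseteq> pivots (V N)"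
    using pivots_tuples[OF order_refl, of N] by blast
  then show ?thesis
    using subspace_eq_if_pivots_subset[OF sub(1) one_sided_subspace_tuples sub(2) order_refl] by blast
qed


section \<open>Interpolation in bounded degree\<close>

definition polys_less :: "nat \<Rightarrow> ('a::division_ring, 'n) skew_poly set" where
  "polys_less d = {F. \<forall>w. d \<le> length w \<longrightarrow> Poly_Mapping.lookup F w = 0}"

lemma deg_poly_less_iff:
  assumes "0 < d"
  shows "deg_poly F < ereal (real d) \<longleftrightarrow> F \<in> polys_less d"
proof (cases "F = 0")
  case False
  have "deg_poly F < ereal (real d) \<longleftrightarrow> (\<forall>w\<in>Poly_Mapping.keys F. length w < d)"
    using False by (simp add: deg_poly_def)
  also have "\<dots> \<longleftrightarrow> (\<forall>w. Poly_Mapping.lookup F w \<noteq> 0 \<longrightarrow> length w < d)"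
    by (auto simp: in_keys_iff)
  also have "\<dots> \<longleftrightarrow> F \<in> polys_less d"
    unfolding polys_less_def mem_Collect_eq by (meson not_less)
  finally show ?thesis .
qed (simp add: deg_poly_def polys_less_def)

lemma polys_less_simps:
  "0 \<in> polys_less d" "F \<in> polys_less d \<Longrightarrow> G \<in> polys_less d \<Longrightarrow> F - G \<in> polys_less d"
  "F \<in> polys_less d \<Longrightarrow> G \<in> polys_less d \<Longrightarrow> F + G \<in> polys_less d"
  "length w < d \<Longrightarrow> Poly_Mapping.single w c \<in> polys_less d"
  "d \<le> e \<Longrightarrow> F \<in> polys_less d \<Longrightarrow> F \<in> polys_less e"
  by (auto simp: polys_less_def lookup_minus lookup_add lookup_single when_def)

lemma polys_less_sum:
  "(\<And>x. x \<in> A \<Longrightarrow> f x \<in> polys_less d) \<Longrightarrow> (\<Sum>x\<in>A. f x) \<in> polys_less d"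
  by (induct A rule: infinite_finite_induct) (auto simp: polys_less_simps)

lemma polys_less_induct [consumes 1, case_names zero add single]:
  fixes F :: "('a::division_ring, 'n) skew_poly"
  assumes F: "F \<in> polys_less d"
    and "P 0" "\<And>F G. P F \<Longrightarrow> P G \<Longrightarrow> P (F + G)"
    and "\<And>w c. length w < d \<Longrightarrow> P (Poly_Mapping.single w c)"
  shows "P F"
proof -
  have "P (\<Sum>w\<in>W. Poly_Mapping.single w (Poly_Mapping.lookup F w))"
    if "finite W" "\<forall>w\<in>W. length w < d" for W
    using that by induct (auto intro: assms)
  moreover have "F = (\<Sum>w\<in>Poly_Mapping.keys F. Poly_Mapping.single w (Poly_Mapping.lookup F w))"
    by (rule poly_mapping_eqI) (auto simp: lookup_sum lookup_single when_def in_keys_iff)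
  moreover have "\<forall>w\<in>Poly_Mapping.keys F. length w < d"
    using F by (force simp: polys_less_def in_keys_iff not_less[symmetric])
  ultimately show ?thesis by (metis finite_keys)
qed

lemma polys_less_exhaust: "\<exists>d. F \<in> polys_less d"
proof -
  have "length w < Suc (Max (length ` Poly_Mapping.keys F))" if "Poly_Mapping.lookup F w \<noteq> 0" for w
    using that by (simp add: in_keys_iff less_Suc_eq_le)
  then have "F \<in> polys_less (Suc (Max (length ` Poly_Mapping.keys F)))"
    unfolding polys_less_def mem_Collect_eq by (meson not_less)
  then show ?thesis by blast
qed

text \<open>
  The assumption on \<open>shift\<close> abstracts from the side on which the common kernel of the functionals is
  an ideal: for a left ideal \<open>shift\<close> is left multiplication by \<open>c x\<^sub>i\<close>, where \<open>x\<^sub>i\<close> is the first letter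
  of \<open>w\<close>; for a right ideal it is right multiplication by the last letter of \<open>w\<close>. In both cases it
  produces the term \<open>c w\<close> from one of lower degree. Hence if every polynomial of degree at most \<open>d\<close>
  is congruent modulo the kernel to one of degree less than \<open>d\<close>, then every polynomial of degree at
  most \<open>d + 1\<close> is congruent to one of degree at most \<open>d\<close>. So the spaces of values form a chain as in
  \<open>chain_of_subspaces_full\<close>; triangularity says that all \<open>N\<close> pivots occur in it.
\<close>

lemma interpolation_in_bounded_degree:
  fixes L :: "nat \<Rightarrow> ('a::division_ring, 'n) skew_poly \<Rightarrow> 'a"
  assumes add: "\<And>p. p < N \<Longrightarrow> Modules.additive (L p)"
    and scale: "\<And>d F p c. F \<in> polys_less d \<Longrightarrow> p < N \<Longrightarrow> L p F \<noteq> 0 \<Longrightarrow>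
      \<exists>G\<in>polys_less d. L p G = c \<and> (\<forall>q<N. L q F = 0 \<longrightarrow> L q G = 0)"
    and shift: "\<And>w c. w \<noteq> [] \<Longrightarrow> \<exists>shift F. Modules.additive shift \<and> F \<in> polys_less (length w) \<and>
      shift F = Poly_Mapping.single w c \<and>
      (\<forall>d G. G \<in> polys_less d \<longrightarrow> shift G \<in> polys_less (Suc d)) \<and>
      (\<forall>G. (\<forall>p<N. L p G = 0) \<longrightarrow> (\<forall>p<N. L p (shift G) = 0))"
    and triangular: "\<And>p. p < N \<Longrightarrow> \<exists>F. L p F \<noteq> 0 \<and> (\<forall>q<p. L q F = 0)"
  shows "\<exists>F\<in>polys_less N. \<forall>p<N. L p F = b p"
proof -
  define val where "val F = (\<lambda>p. if p < N then L p F else 0)" for F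
  define V where "V d = val ` polys_less d" for d
  have val_eq: "val F = val G \<longleftrightarrow> (\<forall>p<N. L p F = L p G)" for F G
    by (auto simp: val_def fun_eq_iff)
  have add': "L p (F + G) = L p F + L p G" "L p (F - G) = L p F - L p G" "L p 0 = 0"
    if "p < N" for p F G
    using add[OF that] by (simp_all add: additive.add additive.diff additive.zero)
  have "V N = tuples N"
  proof (rule chain_of_subspaces_full)
    fix d
    show "V d \<subseteq> tuples N" by (auto simp: V_def val_def tuples_def)
    show "V d \<subseteq> V (Suc d)" unfolding V_def by (intro image_mono) (auto simp: polys_less_def)
    show "one_sided_subspace (V d)"
      unfolding one_sided_subspace_def
    proof (intro conjI ballI allI impI)
      have "val 0 = (\<lambda>_. 0)" by (auto simp: val_def add')
      then show "(\<lambda>_. 0) \<in> V d" unfolding V_def using polys_less_simps(1) by (metis imageI)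
    next
      fix u v assume "u \<in> V d" "v \<in> V d"
      then obtain F G where FG: "F \<in> polys_less d" "u = val F" "G \<in> polys_less d" "v = val G"
        by (auto simp: V_def)
      have "(\<lambda>p. u p - v p) = val (F - G)" by (auto simp: FG val_def add')
      then show "(\<lambda>p. u p - v p) \<in> V d" unfolding V_def using FG polys_less_simps(2) by blast
    next
      fix u p c assume "u \<in> V d" and up: "u p \<noteq> 0"
      then obtain F where F: "F \<in> polys_less d" "u = val F" by (auto simp: V_def)
      with up have "p < N" "L p F \<noteq> 0" by (auto simp: val_def split: if_splits)
      from scale[OF F(1) this, of c] obtain G where
        "G \<in> polys_less d" "L p G = c" "\<forall>q<N. L q F = 0 \<longrightarrow> L q G = 0" by blast
      with \<open>p < N\<close> show "\<exists>u'\<in>V d. u' p = c \<and> (\<forall>q. u q = 0 \<longrightarrow> u' q = 0)"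
        unfolding V_def F(2) by (intro bexI[of _ "val G"]) (auto simp: val_def)
    qed
  next
    fix d assume eq: "V d = V (Suc d)"
    have reduce: "\<exists>G\<in>polys_less d. \<forall>p<N. L p F = L p G" if "F \<in> polys_less (Suc d)" for F
    proof -
      have "val F \<in> V d" using that unfolding eq by (auto simp: V_def)
      then show ?thesis by (auto simp: V_def val_eq)
    qed
    have "\<exists>G\<in>polys_less (Suc d). \<forall>p<N. L p F = L p G" if "F \<in> polys_less (Suc (Suc d))" for F
      using that
    proof (induct F rule: polys_less_induct)
      case zero
      show ?case using polys_less_simps(1) by blast
    next
      case (add F G)
      then obtain F' G' where "F' \<in> polys_less (Suc d)" "\<forall>p<N. L p F = L p F'"
        "G' \<in> polys_less (Suc d)" "\<forall>p<N. L p G = L p G'" by blast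
      then show ?case by (intro bexI[of _ "F' + G'"]) (auto simp: add' polys_less_simps)
    next
      case (single w c)
      show ?case
      proof (cases "w = []")
        case True
        then show ?thesis by (intro bexI[of _ "Poly_Mapping.single w c"]) (auto simp: polys_less_simps)
      next
        case False
        then obtain sh F where sh: "Modules.additive sh" "F \<in> polys_less (length w)"
          "sh F = Poly_Mapping.single w c" "\<forall>d G. G \<in> polys_less d \<longrightarrow> sh G \<in> polys_less (Suc d)"
          "\<forall>G. (\<forall>p<N. L p G = 0) \<longrightarrow> (\<forall>p<N. L p (sh G) = 0)" using shift by metis
        have "F \<in> polys_less (Suc d)" using sh(2) single polys_less_simps(5) by (metis less_Suc_eq_le)
        then obtain G where G: "G \<in> polys_less d" "\<forall>p<N. L p F = L p G" using reduce by blast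
        then have "\<forall>p<N. L p (F - G) = 0" by (simp add: add')
        then have "\<forall>p<N. L p (sh (F - G)) = 0" using sh(5) by blast
        then have "\<forall>p<N. L p (Poly_Mapping.single w c) = L p (sh G)"
          using additive.diff[OF sh(1), of F G] sh(3) by (simp add: add')
        then show ?thesis using sh(4) G(1) by blast
      qed
    qed
    then have "V (Suc (Suc d)) \<subseteq> V (Suc d)"
      unfolding V_def image_subset_iff by (metis imageI val_eq)
    moreover have "V (Suc d) \<subseteq> V (Suc (Suc d))"
      unfolding V_def by (intro image_mono) (auto simp: polys_less_def)
    ultimately show "V (Suc d) = V (Suc (Suc d))" by blast
  next
    show "{..<N} \<subseteq> (\<Union>d. pivots (V d))"
    proof
      fix p assume "p \<in> {..<N}"
      then have p: "p < N" by simp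
      from triangular[OF this] obtain F where F: "L p F \<noteq> 0" "\<forall>q<p. L q F = 0" by blast
      obtain d where "F \<in> polys_less d" using polys_less_exhaust by blast
      with F p show "p \<in> (\<Union>d. pivots (V d))"
        by (force simp: pivots_def V_def val_def)
    qed
  qed
  moreover have "(\<lambda>p. if p < N then b p else 0) \<in> tuples N" by (simp add: tuples_def)
  ultimately obtain F where "F \<in> polys_less N" "(\<lambda>p. if p < N then b p else 0) = val F"
    unfolding V_def by blast
  then show ?thesis by (intro bexI[of _ F]) (auto simp: val_def fun_eq_iff split: if_splits)
qed


section \<open>Conditions indexed by points and orders\<close>

text \<open>
  The pairs (point, order of derivation) in the order of the columns of the right, respectively the
  rows of the left confluent Vandermonde matrix.
\<close>

definition positions :: "'b list list \<Rightarrow> (nat \<times> nat) list" where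
  "positions ms = concat (map (\<lambda>j. map (Pair j) [0..<Suc (length (ms ! j))]) [0..<length ms])"

lemma set_positions: "set (positions ms) = {(j, i). j < length ms \<and> i \<le> length (ms ! j)}"
  by (auto simp: positions_def simp del: upt_Suc)

lemma ball_positions:
  "(\<forall>(j, i)\<in>{(j, i). j < n \<and> i \<le> l j}. P j i) \<longleftrightarrow> (\<forall>j<n. \<forall>i\<le>l j. P j i)"
  by auto

lemma length_positions: "length (positions ms) = (\<Sum>j<length ms. length (ms ! j) + 1)"
  by (simp add: positions_def length_concat comp_def interv_sum_list_conv_sum_set_nat
      atLeast0LessThan del: upt_Suc)

lemma positions_lexicographic:
  "sorted_wrt (\<lambda>(j', i') (j, i). j' < j \<or> j' = j \<and> i' < i) (positions ms)"
proof -
  have "sorted_wrt (\<lambda>(j', i') (j, i). j' < j \<or> j' = j \<and> i' < i)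
          (concat (map (\<lambda>j. map (Pair j) [0..<l j]) [0..<k]))" for l :: "nat \<Rightarrow> nat" and k
    by (induct k) (auto simp: sorted_wrt_append sorted_wrt_map)
  then show ?thesis unfolding positions_def .
qed

text \<open>
  The pair \<open>(j, i)\<close> stands for the order \<open>i\<close> at the point \<open>j\<close>. Everything that precedes \<open>(j, i)\<close> in the
  lexicographic order is at another point or of lower order at the same point, so the system on the
  left is triangular in the order of \<open>positions\<close>. Conversely, interpolating a unit vector gives the
  required polynomial.
\<close>

lemma triangular_iff_interpolation:
  fixes f :: "nat \<Rightarrow> nat \<Rightarrow> ('a::division_ring, 'n) skew_poly \<Rightarrow> 'a" and ms :: "'b list list"
  defines "I \<equiv> {(j, i). j < length ms \<and> i \<le> length (ms ! j)}"
    and "N \<equiv> \<Sum>j<length ms. length (ms ! j) + 1"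
  assumes add: "\<And>j i. (j, i) \<in> I \<Longrightarrow> Modules.additive (f j i)"
    and scale: "\<And>d F j i c. F \<in> polys_less d \<Longrightarrow> (j, i) \<in> I \<Longrightarrow> f j i F \<noteq> 0 \<Longrightarrow>
      \<exists>G\<in>polys_less d. f j i G = c \<and> (\<forall>(j', i')\<in>I. f j' i' F = 0 \<longrightarrow> f j' i' G = 0)"
    and shift: "\<And>w c. w \<noteq> [] \<Longrightarrow> \<exists>shift F. Modules.additive shift \<and> F \<in> polys_less (length w) \<and>
      shift F = Poly_Mapping.single w c \<and>
      (\<forall>d G. G \<in> polys_less d \<longrightarrow> shift G \<in> polys_less (Suc d)) \<and>
      (\<forall>G. (\<forall>(j, i)\<in>I. f j i G = 0) \<longrightarrow> (\<forall>(j, i)\<in>I. f j i (shift G) = 0))"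
  shows "(\<forall>(j, i)\<in>I. \<exists>F. f j i F \<noteq> 0 \<and>
            (\<forall>(j', i')\<in>I. j' \<noteq> j \<or> i' < i \<longrightarrow> f j' i' F = 0)) \<longleftrightarrow>
         (\<forall>b. \<exists>F\<in>polys_less N. \<forall>(j, i)\<in>I. f j i F = b j i)" (is "?tri \<longleftrightarrow> ?int")
proof
  assume tri: ?tri
  let ?L = "\<lambda>p. case positions ms ! p of (j, i) \<Rightarrow> f j i"
  have N: "N = length (positions ms)" by (simp add: N_def length_positions)
  have I: "I = set (positions ms)" by (simp add: I_def set_positions)
  have all_I: "(\<forall>(j, i)\<in>I. P j i) \<longleftrightarrow> (\<forall>p<N. case positions ms ! p of (j, i) \<Rightarrow> P j i)" for P
    unfolding I N by (simp add: all_set_conv_all_nth)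
  have pos: "positions ms ! p \<in> I" if "p < N" for p using that by (simp add: I N)
  show ?int
  proof
    fix b
    have "\<exists>F\<in>polys_less N. \<forall>p<N. ?L p F = (case positions ms ! p of (j, i) \<Rightarrow> b j i)"
    proof (rule interpolation_in_bounded_degree)
      show "Modules.additive (?L p)" if "p < N" for p
        using pos[OF that] add by (auto split: prod.split)
      show "\<exists>G\<in>polys_less d. ?L p G = c \<and> (\<forall>q<N. ?L q F = 0 \<longrightarrow> ?L q G = 0)"
        if F: "F \<in> polys_less d" "p < N" "?L p F \<noteq> 0" for d F p c
      proof -
        obtain j i where ji: "positions ms ! p = (j, i)" by fastforce
        obtain G where G: "G \<in> polys_less d" "f j i G = c"
          "\<forall>(j', i')\<in>I. f j' i' F = 0 \<longrightarrow> f j' i' G = 0"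
          using scale[OF F(1), of j i c] pos[OF F(2)] F(3) ji by auto
        from G(3) have "\<forall>q<N. ?L q F = 0 \<longrightarrow> ?L q G = 0"
          unfolding all_I by (auto split: prod.splits)
        with G(1,2) ji show ?thesis by auto
      qed
      show "\<exists>shift F. Modules.additive shift \<and> F \<in> polys_less (length w) \<and>
          shift F = Poly_Mapping.single w c \<and>
          (\<forall>d G. G \<in> polys_less d \<longrightarrow> shift G \<in> polys_less (Suc d)) \<and>
          (\<forall>G. (\<forall>p<N. ?L p G = 0) \<longrightarrow> (\<forall>p<N. ?L p (shift G) = 0))"
        if "w \<noteq> []" for w c
        using shift[OF that, of c] unfolding all_I by (simp add: case_prod_beta)
      show "\<exists>F. ?L p F \<noteq> 0 \<and> (\<forall>q<p. ?L q F = 0)" if p: "p < N" for p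
      proof -
        obtain j i where ji: "positions ms ! p = (j, i)" by fastforce
        with pos[OF p] tri obtain F where F: "f j i F \<noteq> 0"
          "\<forall>(j', i')\<in>I. j' \<noteq> j \<or> i' < i \<longrightarrow> f j' i' F = 0" by fastforce
        have "?L q F = 0" if q: "q < p" for q
        proof -
          obtain j' i' where ji': "positions ms ! q = (j', i')" by fastforce
          have "j' < j \<or> j' = j \<and> i' < i"
            using sorted_wrt_nth_less[OF positions_lexicographic q, of ms] p N ji ji' by simp
          then show ?thesis using pos[of q] q p ji' F(2) by auto
        qed
        with F(1) ji show ?thesis by auto
      qed
    qed
    then show "\<exists>F\<in>polys_less N. \<forall>(j, i)\<in>I. f j i F = b j i"
      unfolding all_I by (simp add: case_prod_beta)
  qed
next
  assume int: ?int
  show ?tri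
  proof (safe)
    fix j i assume "(j, i) \<in> I"
    from int[rule_format, of "\<lambda>j' i'. if j' = j \<and> i' = i then 1 else 0"]
    obtain F where "\<forall>(j', i')\<in>I. f j' i' F = (if j' = j \<and> i' = i then 1 else 0)" by blast
    with \<open>(j, i) \<in> I\<close> show "\<exists>F. f j i F \<noteq> 0 \<and>
            (\<forall>(j', i')\<in>I. j' \<noteq> j \<or> i' < i \<longrightarrow> f j' i' F = 0)"
      by (intro exI[of _ F]) (auto split: if_splits)
  qed
qed


section \<open>DP-independence as triangularity\<close>

text \<open>
  Both vanishing sets have this form; \<open>ev a m i F\<close> is the evaluation at \<open>a\<close> of the derivative of
  \<open>F\<close> along the suffix, respectively prefix, of length \<open>i\<close> of \<open>m\<close>.
\<close>

definition vanishing :: "('p \<Rightarrow> 'b list \<Rightarrow> nat \<Rightarrow> 'r \<Rightarrow> 'a::zero) \<Rightarrow> 'p list \<Rightarrow> 'b list list \<Rightarrow> 'r set"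
  where "vanishing ev pts ms =
     {F. \<forall>j<length pts. \<forall>i\<le>length (ms ! j). ev (pts ! j) (ms ! j) i F = 0}"

lemma ball_set_remove_nth:
  "(\<forall>x\<in>set (remove_nth j xs). P x) \<longleftrightarrow> (\<forall>i<length xs. i \<noteq> j \<longrightarrow> P (xs ! i))"
proof (induct xs arbitrary: j)
  case Nil
  show ?case by (simp add: remove_nth_def)
next
  case (Cons x xs)
  show ?case
  proof (cases j)
    case 0
    then show ?thesis by (simp add: remove_nth_def All_less_Suc2 all_set_conv_all_nth)
  next
    case (Suc j')
    then have "remove_nth j (x # xs) = x # remove_nth j' xs" by (simp add: remove_nth_def)
    then show ?thesis using Cons[of j'] Suc by (simp add: All_less_Suc2)
  qed
qed

lemma vanishing_zip:
  assumes "length pts = length ms"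
  shows "F \<in> vanishing ev pts ms \<longleftrightarrow> (\<forall>(a, m)\<in>set (zip pts ms). \<forall>i\<le>length m. ev a m i F = 0)"
  using assms by (simp add: vanishing_def all_set_conv_all_nth)

lemma vanishing_remove_nth:
  assumes "length pts = length ms" "j < length ms"
  shows "F \<in> vanishing ev (remove_nth j pts) (remove_nth j ms) \<longleftrightarrow>
     (\<forall>j'<length ms. j' \<noteq> j \<longrightarrow> (\<forall>i\<le>length (ms ! j'). ev (pts ! j') (ms ! j') i F = 0))"
proof -
  have "zip (remove_nth j pts) (remove_nth j ms) = remove_nth j (zip pts ms)"
    using assms by (simp add: remove_nth_def zip_append take_zip drop_zip)
  then show ?thesis
    using assms by (subst vanishing_zip) (simp_all add: ball_set_remove_nth, simp add: remove_nth_def)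
qed

lemma vanishing_snoc:
  assumes "length pts = length ms"
  shows "F \<in> vanishing ev (pts @ [a]) (ms @ [m]) \<longleftrightarrow>
     F \<in> vanishing ev pts ms \<and> (\<forall>i\<le>length m. ev a m i F = 0)"
  using assms by (auto simp: vanishing_zip)

text \<open>
  The set after a step is the set before it cut down by a single new condition, so the step is strict
  exactly if a member of the larger set violates that condition.
\<close>

lemma strict_chain_iff_triangular:
  assumes len: "length pts = length ms" and j: "j < length ms"
    and sub: "\<And>l m. l \<le> length m \<Longrightarrow> length (sub l m) = l"
      "\<And>a m l i. i \<le> l \<Longrightarrow> l \<le> length m \<Longrightarrow> ev a (sub l m) i = ev a m i"
  defines "A \<equiv> vanishing ev (remove_nth j pts) (remove_nth j ms)"
    and "B \<equiv> \<lambda>l. vanishing ev (remove_nth j pts @ [pts ! j]) (remove_nth j ms @ [sub l (ms ! j)])"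
  shows "B 0 \<subset> A \<and> (\<forall>i<length (ms ! j). B (Suc i) \<subset> B i) \<longleftrightarrow>
     (\<forall>i\<le>length (ms ! j). \<exists>F. ev (pts ! j) (ms ! j) i F \<noteq> 0 \<and>
        (\<forall>j'<length ms. \<forall>i'\<le>length (ms ! j'). j' \<noteq> j \<or> i' < i \<longrightarrow> ev (pts ! j') (ms ! j') i' F = 0))"
    (is "_ \<longleftrightarrow> (\<forall>i\<le>_. \<exists>F. ?tri i F)")
proof -
  have len': "length (remove_nth j pts) = length (remove_nth j ms)"
    using len j by (simp add: remove_nth_def)
  have B: "F \<in> B l \<longleftrightarrow> F \<in> A \<and> (\<forall>i\<le>l. ev (pts ! j) (ms ! j) i F = 0)"
    if "l \<le> length (ms ! j)" for F l
    using that by (simp add: A_def B_def vanishing_snoc[OF len'] sub)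
  have A: "F \<in> A \<longleftrightarrow>
      (\<forall>j'<length ms. j' \<noteq> j \<longrightarrow> (\<forall>i\<le>length (ms ! j'). ev (pts ! j') (ms ! j') i F = 0))" for F
    unfolding A_def by (rule vanishing_remove_nth[OF len j])
  have tri: "?tri i F \<longleftrightarrow>
      F \<in> A \<and> (\<forall>i'<i. ev (pts ! j) (ms ! j) i' F = 0) \<and> ev (pts ! j) (ms ! j) i F \<noteq> 0"
    if "i \<le> length (ms ! j)" for i F
    using that j unfolding A by (metis le_trans less_imp_le)
  \<comment> \<open>\<open>B 0\<close> adds the condition of order \<open>0\<close> to \<open>A\<close>, and \<open>B (Suc i)\<close> that of order \<open>Suc i\<close> to \<open>B i\<close>.\<close>
  have split_zero: "(\<forall>i\<le>n. P i) \<longleftrightarrow> P 0 \<and> (\<forall>i<n. P (Suc i))" for P and n :: nat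
    using All_less_Suc2[of n P] by (simp add: less_Suc_eq_le)
  have "B 0 \<subseteq> A" using B[OF le0] by blast
  then have "B 0 \<subset> A \<longleftrightarrow> (\<exists>F\<in>A. F \<notin> B 0)" by blast
  also have "\<dots> \<longleftrightarrow> (\<exists>F. ?tri 0 F)" unfolding tri[OF le0] Bex_def B[OF le0] by auto
  finally have start: "B 0 \<subset> A \<longleftrightarrow> (\<exists>F. ?tri 0 F)" .
  have step: "B (Suc i) \<subset> B i \<longleftrightarrow> (\<exists>F. ?tri (Suc i) F)" if "i < length (ms ! j)" for i
  proof -
    have "B (Suc i) \<subseteq> B i" using that by (auto simp: B)
    then have "B (Suc i) \<subset> B i \<longleftrightarrow> (\<exists>F\<in>B i. F \<notin> B (Suc i))" by blast
    also have "\<dots> \<longleftrightarrow> (\<exists>F. ?tri (Suc i) F)"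
      unfolding tri[OF Suc_leI[OF that]] Bex_def B[OF Suc_leI[OF that]] B[OF less_imp_le[OF that]]
      by (auto simp: le_Suc_eq less_Suc_eq_le)
    finally show ?thesis .
  qed
  have "B 0 \<subset> A \<and> (\<forall>i<length (ms ! j). B (Suc i) \<subset> B i) \<longleftrightarrow>
      (\<exists>F. ?tri 0 F) \<and> (\<forall>i<length (ms ! j). \<exists>F. ?tri (Suc i) F)"
    by (intro conj_cong start all_cong1 imp_cong refl step)
  also have "\<dots> \<longleftrightarrow> (\<forall>i\<le>length (ms ! j). \<exists>F. ?tri i F)"
    by (rule split_zero[symmetric])
  finally show ?thesis .
qed

lemma nth_notin_remove_nth: "distinct xs \<Longrightarrow> j < length xs \<Longrightarrow> xs ! j \<notin> set (remove_nth j xs)"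
  using ball_set_remove_nth[of j xs "\<lambda>x. x \<noteq> xs ! j"] by (auto simp: nth_eq_iff_index_eq)


section \<open>Linear systems with one equation for each condition\<close>

text \<open>
  Here \<open>comb\<close> turns a coefficient vector into a polynomial and \<open>P\<close> is the linear system. Both are left
  open because the coefficients stand on different sides of the monomials in the two versions.
\<close>

lemma interpolation_iff_solvable:
  fixes f :: "nat \<Rightarrow> nat \<Rightarrow> ('a::division_ring, 'n) skew_poly \<Rightarrow> 'a" and ms :: "'b list list"
    and P :: "'a Matrix.vec list \<Rightarrow> 'a Matrix.vec \<Rightarrow> bool"
  assumes surj: "polys_less N = comb ` carrier_vec r"
    and solution: "\<And>bs z. length bs = k \<Longrightarrow> \<forall>j<k. bs ! j \<in> carrier_vec (length (ms ! j) + 1) \<Longrightarrow>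
      z \<in> carrier_vec r \<Longrightarrow>
      P bs z \<longleftrightarrow> (\<forall>j<k. \<forall>i\<le>length (ms ! j). f j i (comb z) = vec_index (bs ! j) i)"
  shows "(\<forall>b. \<exists>F\<in>polys_less N. \<forall>j<k. \<forall>i\<le>length (ms ! j). f j i F = b j i) \<longleftrightarrow>
     (\<forall>bs. length bs = k \<and> (\<forall>j<k. bs ! j \<in> carrier_vec (length (ms ! j) + 1)) \<longrightarrow>
        (\<exists>z\<in>carrier_vec r. P bs z))" (is "?int \<longleftrightarrow> ?sol")
proof
  assume int: ?int
  show ?sol
  proof (intro allI impI, elim conjE)
    fix bs :: "'a Matrix.vec list"
    assume bs: "length bs = k" "\<forall>j<k. bs ! j \<in> carrier_vec (length (ms ! j) + 1)"
    obtain F where "F \<in> polys_less N" "\<forall>j<k. \<forall>i\<le>length (ms ! j). f j i F = vec_index (bs ! j) i"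
      using int[rule_format, of "\<lambda>j i. vec_index (bs ! j) i"] by blast
    then show "\<exists>z\<in>carrier_vec r. P bs z" unfolding surj using solution[OF bs] by blast
  qed
next
  assume sol: ?sol
  show ?int
  proof
    fix b :: "nat \<Rightarrow> nat \<Rightarrow> 'a"
    define bs where "bs = map (\<lambda>j. Matrix.vec (length (ms ! j) + 1) (b j)) [0..<k]"
    have bs: "length bs = k" "\<forall>j<k. bs ! j \<in> carrier_vec (length (ms ! j) + 1)"
      by (simp_all add: bs_def)
    with sol obtain z where z: "z \<in> carrier_vec r" "P bs z" by blast
    then have "\<forall>j<k. \<forall>i\<le>length (ms ! j). f j i (comb z) = b j i"
      using solution[OF bs z(1)] by (simp add: bs_def)
    moreover have "comb z \<in> polys_less N" using z(1) surj by blast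
    ultimately show "\<exists>F\<in>polys_less N. \<forall>j<k. \<forall>i\<le>length (ms ! j). f j i F = b j i" by blast
  qed
qed

lemma concat_map2_positions:
  assumes "length pts = length ms" "\<And>a m. f a m = map (g a m) [0..<Suc (length m)]"
  shows "concat (map2 f pts ms) = map (\<lambda>(j, i). g (pts ! j) (ms ! j) i) (positions ms)"
proof -
  have "map2 f pts ms = map (\<lambda>j. f (pts ! j) (ms ! j)) [0..<length ms]"
    by (rule nth_equalityI) (use assms(1) in auto)
  then show ?thesis
    unfolding positions_def map_concat map_map by (simp add: comp_def assms(2) del: upt_Suc)
qed

lemma concat_vec_positions:
  assumes "length bs = length ms" "\<forall>j<length ms. bs ! j \<in> carrier_vec (length (ms ! j) + 1)"
  shows "concat_vec bs = vec_of_list (map (\<lambda>(j, i). vec_index (bs ! j) i) (positions ms))"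
proof -
  have "list_of_vec (bs ! j) = map (vec_index (bs ! j)) [0..<Suc (length (ms ! j))]"
    if "j < length ms" for j
    using assms(2) that by (intro nth_equalityI) (auto simp del: upt_Suc)
  then have "map list_of_vec bs =
      map (\<lambda>j. map (vec_index (bs ! j)) [0..<Suc (length (ms ! j))]) [0..<length ms]"
    using assms(1) by (intro nth_equalityI) (auto simp del: upt_Suc)
  then show ?thesis
    unfolding concat_vec_def positions_def map_concat map_map by (simp add: comp_def del: upt_Suc)
qed

lemma mat_of_row_mult_mat_of_cols:
  assumes z: "z \<in> carrier_vec r" and xs: "\<And>x. x \<in> set xs \<Longrightarrow> g x \<in> carrier_vec r"
  shows "mat_of_row z * mat_of_cols r (map g xs) = mat_of_row (vec_of_list (map h xs)) \<longleftrightarrow>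
     (\<forall>x\<in>set xs. scalar_prod z (g x) = h x)"
proof -
  have "mat_of_row z * mat_of_cols r (map g xs) = mat_of_row (vec_of_list (map h xs)) \<longleftrightarrow>
     (\<forall>p<length xs. scalar_prod z (g (xs ! p)) = h (xs ! p))"
    using z xs by (auto simp: mat_eq_iff vec_of_list_index)
  then show ?thesis by (simp add: all_set_conv_all_nth)
qed

lemma mat_of_rows_mult_vec:
  assumes z: "z \<in> carrier_vec r" and xs: "\<And>x. x \<in> set xs \<Longrightarrow> g x \<in> carrier_vec r"
  shows "mat_of_rows r (map g xs) *\<^sub>v z = vec_of_list (map h xs) \<longleftrightarrow>
     (\<forall>x\<in>set xs. scalar_prod (g x) z = h x)"
proof -
  have "mat_of_rows r (map g xs) *\<^sub>v z = vec_of_list (map h xs) \<longleftrightarrow>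
     (\<forall>p<length xs. scalar_prod (g (xs ! p)) z = h (xs ! p))"
    using z xs by (auto simp: vec_eq_iff vec_of_list_index)
  then show ?thesis by (simp add: all_set_conv_all_nth)
qed

lemma length_monomials:
  fixes mons :: "'n::finite list list"
  assumes "lists_monomials N mons"
  shows "length mons = (\<Sum>i<N. CARD('n) ^ i)"
proof -
  have "card {w :: 'n list. length w < N} = (\<Sum>i<N. CARD('n) ^ i) \<and> finite {w :: 'n list. length w < N}"
  proof (induct N)
    case (Suc N)
    have "{w :: 'n list. length w < Suc N} = {w. length w < N} \<union> {w. length w = N}" by auto
    moreover have "card {w :: 'n list. length w = N} = CARD('n) ^ N"
      "finite {w :: 'n list. length w = N}"
      using card_lists_length_eq[of "UNIV :: 'n set" N] finite_lists_length_eq[of "UNIV :: 'n set" N]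
      by simp_all
    moreover have "{w :: 'n list. length w < N} \<inter> {w. length w = N} = {}" by auto
    ultimately show ?case using Suc by (simp add: card_Un_disjoint)
  qed simp
  with assms show ?thesis by (metis distinct_card lists_monomials_def)
qed

lemma sum_monomials:
  assumes "lists_monomials N mons"
  shows "(\<Sum>w\<in>{w. length w < N}. g w) = (\<Sum>s<length mons. g (mons ! s))"
proof -
  have "bij_betw ((!) mons) {..<length mons} {w. length w < N}"
    using assms by (metis bij_betw_nth lists_monomials_def)
  then show ?thesis by (simp add: sum.reindex_bij_betw)
qed

lemma polys_less_eq_left_combinations:
  assumes mons: "lists_monomials N mons"
  shows "(polys_less N :: ('a::division_ring, 'n) skew_poly set) =
     (\<lambda>z. \<Sum>s<length mons. Poly_Mapping.single (mons ! s) (vec_index z s)) ` carrier_vec (length mons)"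
    (is "_ = ?comb ` _")
proof (intro equalityI subsetI)
  fix F :: "('a, 'n) skew_poly" assume F: "F \<in> polys_less N"
  have fin: "finite {w :: 'n list. length w < N}"
    using mons by (metis List.finite_set lists_monomials_def)
  have "F = (\<Sum>w\<in>{w. length w < N}. Poly_Mapping.single w (Poly_Mapping.lookup F w))"
    by (rule poly_mapping_eqI)
       (use F fin in \<open>auto simp: lookup_sum lookup_single when_def polys_less_def\<close>)
  also have "\<dots> = ?comb (Matrix.vec (length mons) (\<lambda>s. Poly_Mapping.lookup F (mons ! s)))"
    unfolding sum_monomials[OF mons] by simp
  finally show "F \<in> ?comb ` carrier_vec (length mons)" by (rule image_eqI) simp
next
  fix F :: "('a, 'n) skew_poly" assume "F \<in> ?comb ` carrier_vec (length mons)"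
  then obtain z where F: "F = ?comb z" by blast
  have "length (mons ! s) < N" if "s < length mons" for s
    using mons nth_mem[OF that] by (auto simp: lists_monomials_def)
  then show "F \<in> polys_less N"
    unfolding F by (intro polys_less_sum polys_less_simps) simp
qed


section \<open>Right evaluations of derivatives\<close>

context
  fixes \<sigma> :: "'a::division_ring \<Rightarrow> 'a ^ 'n::finite ^ 'n" and \<delta> :: "'a \<Rightarrow> 'a ^ 'n"
  assumes hom: "ring_hom_mat \<sigma>" and der: "vector_derivation \<sigma> \<delta>"
begin

lemmas mult_add_left = skew_mult_add_left[OF hom der]
  and mult_add_right = skew_mult_add_right[OF hom der]
  and mult_assoc = skew_mult_assoc[OF hom der]
  and mult_const_left = skew_mult_const_left[OF hom der]
  and mult_sum_left = additive.sum[OF skew_mult_additive(1)[OF hom der]]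
  and mult_sum_right = additive.sum[OF skew_mult_additive(2)[OF hom der]]
  and mult_zero_right = additive.zero[OF skew_mult_additive(2)[OF hom der]]

lemma const_zero: "const 0 = (0 :: ('a, 'n) skew_poly)"
  by (simp add: const_def)

lemma mult_const_const:
  "skew_mult \<sigma> \<delta> (const a) (const b) = (const (a * b) :: ('a, 'n) skew_poly)"
  unfolding mult_const_left by (simp add: const_def)

lemma right_div_eqI:
  assumes "F = (\<Sum>i\<in>UNIV. skew_mult \<sigma> \<delta> (Q i) (var i - const (a $ i))) + const c"
  shows "right_div \<sigma> \<delta> a F = (Q, c)"
  unfolding right_div_def
  by (rule the1_equality[OF right_division_unique[OF hom der]]) (simp add: assms)

lemma right_div_decomposition:
  "F = (\<Sum>i\<in>UNIV. skew_mult \<sigma> \<delta> (fst (right_div \<sigma> \<delta> a F) i) (var i - const (a $ i)))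
       + const (reval \<sigma> \<delta> a F)"
proof -
  have "case right_div \<sigma> \<delta> a F of (Q, c) \<Rightarrow>
      F = (\<Sum>i\<in>UNIV. skew_mult \<sigma> \<delta> (Q i) (var i - const (a $ i))) + const c"
    unfolding right_div_def by (rule theI'[OF right_division_unique[OF hom der]])
  then show ?thesis unfolding reval_def case_prod_beta .
qed

lemma right_div_add:
  "right_div \<sigma> \<delta> a (F + G) = (\<lambda>i. fst (right_div \<sigma> \<delta> a F) i + fst (right_div \<sigma> \<delta> a G) i,
     reval \<sigma> \<delta> a F + reval \<sigma> \<delta> a G)"
proof (rule right_div_eqI)
  show "F + G = (\<Sum>i\<in>UNIV. skew_mult \<sigma> \<delta> (fst (right_div \<sigma> \<delta> a F) i + fst (right_div \<sigma> \<delta> a G) i)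
      (var i - const (a $ i))) + const (reval \<sigma> \<delta> a F + reval \<sigma> \<delta> a G)"
    by (subst (1) right_div_decomposition[of F a], subst (1) right_div_decomposition[of G a])
       (simp add: mult_add_left sum.distrib const_def single_add algebra_simps)
qed

lemma right_div_lscale:
  "right_div \<sigma> \<delta> a (lscale c F) =
     (\<lambda>i. lscale c (fst (right_div \<sigma> \<delta> a F) i), c * reval \<sigma> \<delta> a F)"
proof (rule right_div_eqI)
  show "lscale c F = (\<Sum>i\<in>UNIV. skew_mult \<sigma> \<delta> (lscale c (fst (right_div \<sigma> \<delta> a F) i))
      (var i - const (a $ i))) + const (c * reval \<sigma> \<delta> a F)"
    by (subst (1) right_div_decomposition[of F a])
       (simp add: mult_const_left[symmetric] mult_assoc mult_add_right mult_sum_right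
         mult_const_const)
qed

lemma right_div_mult:
  assumes "reval \<sigma> \<delta> a F = 0"
  shows "right_div \<sigma> \<delta> a (skew_mult \<sigma> \<delta> G F) =
     (\<lambda>i. skew_mult \<sigma> \<delta> G (fst (right_div \<sigma> \<delta> a F) i), 0)"
proof (rule right_div_eqI)
  show "skew_mult \<sigma> \<delta> G F = (\<Sum>i\<in>UNIV. skew_mult \<sigma> \<delta> (skew_mult \<sigma> \<delta> G (fst (right_div \<sigma> \<delta> a F) i))
      (var i - const (a $ i))) + const 0"
    by (subst (1) right_div_decomposition[of F a])
       (simp add: assms const_zero mult_assoc mult_sum_right)
qed

lemma rderiv_simps:
  "rderiv \<sigma> \<delta> a [] F = F"
  "rderiv \<sigma> \<delta> a (x # m) F = fst (right_div \<sigma> \<delta> a (rderiv \<sigma> \<delta> a m F)) x"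
  by (simp_all add: rderiv_def)

lemma rderiv_add: "rderiv \<sigma> \<delta> a m (F + G) = rderiv \<sigma> \<delta> a m F + rderiv \<sigma> \<delta> a m G"
  by (induct m) (simp_all add: rderiv_simps right_div_add)

lemma rderiv_lscale: "rderiv \<sigma> \<delta> a m (lscale c F) = lscale c (rderiv \<sigma> \<delta> a m F)"
  by (induct m) (simp_all add: rderiv_simps right_div_lscale)

lemma additive_reval_rderiv: "Modules.additive (\<lambda>F. reval \<sigma> \<delta> a (rderiv \<sigma> \<delta> a m F))"
  by (simp add: Modules.additive_def rderiv_add right_div_add reval_def)

lemma reval_rderiv_lscale:
  "reval \<sigma> \<delta> a (rderiv \<sigma> \<delta> a m (lscale c F)) = c * reval \<sigma> \<delta> a (rderiv \<sigma> \<delta> a m F)"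
  by (simp add: rderiv_lscale right_div_lscale reval_def)

lemma suffix_of_len_0: "suffix_of_len 0 m = []"
  by (simp add: suffix_of_len_def)

lemma suffix_of_len_Suc:
  assumes "i < length m"
  shows "\<exists>x. suffix_of_len (Suc i) m = x # suffix_of_len i m"
  using Cons_nth_drop_Suc[of "length m - Suc i" m] assms
  by (auto simp: suffix_of_len_def Suc_diff_Suc intro!: exI[of _ "m ! (length m - Suc i)"])

text \<open>
  If \<open>F\<close> vanishes at \<open>a\<close>, multiplying its division by \<open>G\<close> from the left gives the division of \<open>G F\<close>,
  so that a first derivative of \<open>G F\<close> is \<open>G\<close> times that of \<open>F\<close>. Vanishing along all suffixes repeats
  this at every order.
\<close>

lemma reval_rderiv_mult:
  assumes "\<forall>i\<le>length m. reval \<sigma> \<delta> a (rderiv \<sigma> \<delta> a (suffix_of_len i m) F) = 0"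
    and "i \<le> length m"
  shows "reval \<sigma> \<delta> a (rderiv \<sigma> \<delta> a (suffix_of_len i m) (skew_mult \<sigma> \<delta> G F)) = 0"
proof -
  have "rderiv \<sigma> \<delta> a (suffix_of_len i m) (skew_mult \<sigma> \<delta> G F) =
      skew_mult \<sigma> \<delta> G (rderiv \<sigma> \<delta> a (suffix_of_len i m) F)"
    using assms(2)
  proof (induct i)
    case 0
    show ?case by (simp add: suffix_of_len_0 rderiv_simps)
  next
    case (Suc i)
    obtain x where "suffix_of_len (Suc i) m = x # suffix_of_len i m"
      using suffix_of_len_Suc Suc.prems by (metis Suc_le_lessD)
    with Suc assms(1) show ?case by (simp add: rderiv_simps right_div_mult)
  qed
  with assms show ?thesis using right_div_mult by (simp add: reval_def)
qed

lemma mult_single_monomial: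
  "skew_mult \<sigma> \<delta> (Poly_Mapping.single [i] c) (monomial v) = Poly_Mapping.single (i # v) c"
  using foldr_var_mult_single[OF hom der, of "[i]" v]
  by (simp add: skew_mult_single[OF hom der] monomial_def)

lemma polys_less_mult_single:
  assumes "G \<in> polys_less d"
  shows "skew_mult \<sigma> \<delta> (Poly_Mapping.single [i] c) G \<in> polys_less (Suc d)"
  unfolding polys_less_def mem_Collect_eq
proof (intro allI impI)
  fix w :: "'n list" assume "Suc d \<le> length w"
  then show "Poly_Mapping.lookup (skew_mult \<sigma> \<delta> (Poly_Mapping.single [i] c) G) w = 0"
    using assms by (cases w) (auto simp: skew_mult_single[OF hom der] polys_less_def
        lookup_var_mult_Cons[OF hom der] sd_0[OF hom der])
qed

text \<open>
  The functionals are rescaled by left multiplication with constants, and left multiplication by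
  \<open>c x\<^sub>i\<close> prepends the first letter of a word.
\<close>

lemma left_DP_indep_iff_interpolation:
  assumes len: "length pts = length ms" and dist: "distinct pts"
    and N: "N = (\<Sum>j<length ms. length (ms ! j) + 1)"
  shows "left_DP_indep \<sigma> \<delta> pts ms \<longleftrightarrow> (\<forall>b. \<exists>F\<in>polys_less N. \<forall>j<length ms. \<forall>i\<le>length (ms ! j).
     reval \<sigma> \<delta> (pts ! j) (rderiv \<sigma> \<delta> (pts ! j) (suffix_of_len i (ms ! j)) F) = b j i)"
proof -
  define ev where "ev = (\<lambda>a m i F. reval \<sigma> \<delta> a (rderiv \<sigma> \<delta> a (suffix_of_len i m) F))"
  let ?I = "{(j, i). j < length ms \<and> i \<le> length (ms ! j)}"
  have van: "right_van \<sigma> \<delta> = vanishing ev"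
    by (intro ext) (simp add: right_van_def vanishing_def ev_def)
  have "left_DP_indep \<sigma> \<delta> pts ms \<longleftrightarrow> (\<forall>(j, i)\<in>?I. \<exists>F. ev (pts ! j) (ms ! j) i F \<noteq> 0 \<and>
      (\<forall>(j', i')\<in>?I. j' \<noteq> j \<or> i' < i \<longrightarrow> ev (pts ! j') (ms ! j') i' F = 0))"
  proof -
    have "left_DP_indep_point \<sigma> \<delta> (remove_nth j pts) (remove_nth j ms) (pts ! j) (ms ! j) \<longleftrightarrow>
       (\<forall>i\<le>length (ms ! j). \<exists>F. ev (pts ! j) (ms ! j) i F \<noteq> 0 \<and> (\<forall>j'<length ms.
          \<forall>i'\<le>length (ms ! j'). j' \<noteq> j \<or> i' < i \<longrightarrow> ev (pts ! j') (ms ! j') i' F = 0))"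
      if j: "j < length ms" for j
    proof -
      have "pts ! j \<notin> set (remove_nth j pts)" using nth_notin_remove_nth dist j len by metis
      then show ?thesis
        using strict_chain_iff_triangular[OF len j, of suffix_of_len ev]
        by (simp add: left_DP_indep_point_def van suffix_of_len_def ev_def)
    qed
    then show ?thesis
      unfolding left_DP_indep_def len ball_positions by (intro all_cong1 imp_cong refl)
  qed
  also have "\<dots> \<longleftrightarrow> (\<forall>b. \<exists>F\<in>polys_less N. \<forall>(j, i)\<in>?I. ev (pts ! j) (ms ! j) i F = b j i)"
    unfolding N
  proof (rule triangular_iff_interpolation)
    show "Modules.additive (ev (pts ! j) (ms ! j) i)" for j i
      unfolding ev_def by (rule additive_reval_rderiv)
    show "\<exists>G\<in>polys_less d. ev (pts ! j) (ms ! j) i G = c \<and>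
        (\<forall>(j', i')\<in>?I. ev (pts ! j') (ms ! j') i' F = 0 \<longrightarrow> ev (pts ! j') (ms ! j') i' G = 0)"
      if "F \<in> polys_less d" "ev (pts ! j) (ms ! j) i F \<noteq> 0" for d F j i c
      by (rule bexI[of _ "lscale (c * inverse (ev (pts ! j) (ms ! j) i F)) F"])
         (use that in \<open>auto simp: ev_def reval_rderiv_lscale polys_less_def mult.assoc\<close>)
    show "\<exists>shift F. Modules.additive shift \<and> F \<in> polys_less (length w) \<and>
        shift F = Poly_Mapping.single w c \<and>
        (\<forall>d G. G \<in> polys_less d \<longrightarrow> shift G \<in> polys_less (Suc d)) \<and>
        (\<forall>G. (\<forall>(j, i)\<in>?I. ev (pts ! j) (ms ! j) i G = 0) \<longrightarrow>
          (\<forall>(j, i)\<in>?I. ev (pts ! j) (ms ! j) i (shift G) = 0))"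
      if nonempty: "w \<noteq> []" for w c
    proof -
      obtain x v where w: "w = x # v" using nonempty by (cases w) auto
      show ?thesis
      proof (rule exI[of _ "skew_mult \<sigma> \<delta> (Poly_Mapping.single [x] c)"],
          rule exI[of _ "monomial v"], intro conjI allI impI)
        show "Modules.additive (skew_mult \<sigma> \<delta> (Poly_Mapping.single [x] c))"
          by (rule skew_mult_additive[OF hom der])
        show "monomial v \<in> polys_less (length w)"
          unfolding monomial_def w by (rule polys_less_simps) simp
        show "skew_mult \<sigma> \<delta> (Poly_Mapping.single [x] c) (monomial v) = Poly_Mapping.single w c"
          unfolding w by (rule mult_single_monomial)
        show "skew_mult \<sigma> \<delta> (Poly_Mapping.single [x] c) G \<in> polys_less (Suc d)"
          if "G \<in> polys_less d" for d G using that by (rule polys_less_mult_single)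
        show "\<forall>(j, i)\<in>?I. ev (pts ! j) (ms ! j) i (skew_mult \<sigma> \<delta> (Poly_Mapping.single [x] c) G) = 0"
          if "\<forall>(j, i)\<in>?I. ev (pts ! j) (ms ! j) i G = 0" for G
          using that by (auto simp: ev_def intro!: reval_rderiv_mult)
      qed
    qed
  qed
  finally show ?thesis unfolding ball_positions ev_def .
qed


section \<open>Left evaluations of derivatives\<close>

context
  assumes phi: "bij (phi \<sigma>)"
begin

lemma left_div_eqI:
  assumes "F = (\<Sum>i\<in>UNIV. skew_mult \<sigma> \<delta> (var i - const (a $ i)) (Q i)) + const c"
  shows "left_div \<sigma> \<delta> a F = (Q, c)"
  unfolding left_div_def
  by (rule the1_equality[OF left_division_unique[OF hom der phi]]) (simp add: assms)

lemma left_div_decomposition: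
  "F = (\<Sum>i\<in>UNIV. skew_mult \<sigma> \<delta> (var i - const (a $ i)) (fst (left_div \<sigma> \<delta> a F) i))
       + const (leval \<sigma> \<delta> a F)"
proof -
  have "case left_div \<sigma> \<delta> a F of (Q, c) \<Rightarrow>
      F = (\<Sum>i\<in>UNIV. skew_mult \<sigma> \<delta> (var i - const (a $ i)) (Q i)) + const c"
    unfolding left_div_def by (rule theI'[OF left_division_unique[OF hom der phi]])
  then show ?thesis unfolding leval_def case_prod_beta .
qed

lemma left_div_add:
  "left_div \<sigma> \<delta> a (F + G) = (\<lambda>i. fst (left_div \<sigma> \<delta> a F) i + fst (left_div \<sigma> \<delta> a G) i,
     leval \<sigma> \<delta> a F + leval \<sigma> \<delta> a G)"
proof (rule left_div_eqI)
  show "F + G = (\<Sum>i\<in>UNIV. skew_mult \<sigma> \<delta> (var i - const (a $ i))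
      (fst (left_div \<sigma> \<delta> a F) i + fst (left_div \<sigma> \<delta> a G) i))
      + const (leval \<sigma> \<delta> a F + leval \<sigma> \<delta> a G)"
    by (subst (1) left_div_decomposition[of F a], subst (1) left_div_decomposition[of G a])
       (simp add: mult_add_right sum.distrib const_def single_add algebra_simps)
qed

lemma left_div_mult_const:
  "left_div \<sigma> \<delta> a (skew_mult \<sigma> \<delta> F (const c)) =
     (\<lambda>i. skew_mult \<sigma> \<delta> (fst (left_div \<sigma> \<delta> a F) i) (const c), leval \<sigma> \<delta> a F * c)"
proof (rule left_div_eqI)
  show "skew_mult \<sigma> \<delta> F (const c) = (\<Sum>i\<in>UNIV. skew_mult \<sigma> \<delta> (var i - const (a $ i))
      (skew_mult \<sigma> \<delta> (fst (left_div \<sigma> \<delta> a F) i) (const c))) + const (leval \<sigma> \<delta> a F * c)"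
    by (subst (1) left_div_decomposition[of F a])
       (simp add: mult_assoc[symmetric] mult_add_left mult_sum_left mult_const_const)
qed

lemma left_div_mult:
  assumes "leval \<sigma> \<delta> a F = 0"
  shows "left_div \<sigma> \<delta> a (skew_mult \<sigma> \<delta> F G) =
     (\<lambda>i. skew_mult \<sigma> \<delta> (fst (left_div \<sigma> \<delta> a F) i) G, 0)"
proof (rule left_div_eqI)
  show "skew_mult \<sigma> \<delta> F G = (\<Sum>i\<in>UNIV. skew_mult \<sigma> \<delta> (var i - const (a $ i))
      (skew_mult \<sigma> \<delta> (fst (left_div \<sigma> \<delta> a F) i) G)) + const 0"
    by (subst (1) left_div_decomposition[of F a])
       (simp add: assms const_zero mult_assoc[symmetric] mult_sum_left)
qed

lemma lderiv_simps:
  "lderiv \<sigma> \<delta> a [] F = F"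
  "lderiv \<sigma> \<delta> a (m @ [x]) F = fst (left_div \<sigma> \<delta> a (lderiv \<sigma> \<delta> a m F)) x"
  by (simp_all add: lderiv_def)

lemma lderiv_add: "lderiv \<sigma> \<delta> a m (F + G) = lderiv \<sigma> \<delta> a m F + lderiv \<sigma> \<delta> a m G"
  by (induct m rule: rev_induct) (simp_all add: lderiv_simps left_div_add)

lemma lderiv_mult_const:
  "lderiv \<sigma> \<delta> a m (skew_mult \<sigma> \<delta> F (const c)) = skew_mult \<sigma> \<delta> (lderiv \<sigma> \<delta> a m F) (const c)"
  by (induct m rule: rev_induct) (simp_all add: lderiv_simps left_div_mult_const)

lemma additive_leval_lderiv: "Modules.additive (\<lambda>F. leval \<sigma> \<delta> a (lderiv \<sigma> \<delta> a m F))"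
  by (simp add: Modules.additive_def lderiv_add left_div_add leval_def)

lemma leval_lderiv_mult_const:
  "leval \<sigma> \<delta> a (lderiv \<sigma> \<delta> a m (skew_mult \<sigma> \<delta> F (const c)))
     = leval \<sigma> \<delta> a (lderiv \<sigma> \<delta> a m F) * c"
  by (simp add: lderiv_mult_const left_div_mult_const leval_def)

text \<open>The mirror image of \<open>reval_rderiv_mult\<close>: here prefixes and right multiples match.\<close>

lemma leval_lderiv_mult:
  assumes "\<forall>i\<le>length m. leval \<sigma> \<delta> a (lderiv \<sigma> \<delta> a (take i m) F) = 0"
    and "i \<le> length m"
  shows "leval \<sigma> \<delta> a (lderiv \<sigma> \<delta> a (take i m) (skew_mult \<sigma> \<delta> F G)) = 0"
proof -
  have "lderiv \<sigma> \<delta> a (take i m) (skew_mult \<sigma> \<delta> F G) =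
      skew_mult \<sigma> \<delta> (lderiv \<sigma> \<delta> a (take i m) F) G"
    using assms(2)
  proof (induct i)
    case 0
    show ?case by (simp add: lderiv_simps)
  next
    case (Suc i)
    then have "take (Suc i) m = take i m @ [m ! i]" by (simp add: take_Suc_conv_app_nth)
    with Suc assms(1) show ?case by (simp add: lderiv_simps left_div_mult)
  qed
  with assms show ?thesis using left_div_mult by (simp add: leval_def)
qed

lemma mult_single_var:
  "skew_mult \<sigma> \<delta> (Poly_Mapping.single v c) (var i) = Poly_Mapping.single (v @ [i]) c"
  by (simp add: skew_mult_single[OF hom der] var_def monomial_def foldr_var_mult_single[OF hom der])

lemma polys_less_mult_var:
  assumes "G \<in> polys_less d"
  shows "skew_mult \<sigma> \<delta> G (var i) \<in> polys_less (Suc d)"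
  unfolding polys_less_def mem_Collect_eq
proof (intro allI impI)
  fix w :: "'n list" assume "Suc d \<le> length w"
  then show "Poly_Mapping.lookup (skew_mult \<sigma> \<delta> G (var i)) w = 0"
    using assms by (cases w rule: rev_cases)
      (auto simp: polys_less_def lookup_skew_mult_var[OF hom der])
qed

lemma polys_less_mult_const:
  assumes "F \<in> polys_less d"
  shows "skew_mult \<sigma> \<delta> F (const c) \<in> polys_less d"
  unfolding polys_less_def mem_Collect_eq
proof (intro allI impI)
  fix w :: "'n list" assume w: "d \<le> length w"
  have "length v < length w" if "v \<in> Poly_Mapping.keys F" for v
    using assms that w unfolding polys_less_def mem_Collect_eq in_keys_iff by (meson le_trans not_less)
  then show "Poly_Mapping.lookup (skew_mult \<sigma> \<delta> F (const c)) w = 0"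
    by (rule lookup_skew_mult_const_long[OF hom der])
qed

text \<open>
  The functionals are rescaled by right multiplication with constants, which does not raise the
  degree, and right multiplication by \<open>x\<^sub>i\<close> appends the last letter of a word.
\<close>

lemma right_DP_indep_iff_interpolation:
  assumes len: "length pts = length ms" and dist: "distinct pts"
    and N: "N = (\<Sum>j<length ms. length (ms ! j) + 1)"
  shows "right_DP_indep \<sigma> \<delta> pts ms \<longleftrightarrow> (\<forall>b. \<exists>F\<in>polys_less N. \<forall>j<length ms. \<forall>i\<le>length (ms ! j).
     leval \<sigma> \<delta> (pts ! j) (lderiv \<sigma> \<delta> (pts ! j) (take i (ms ! j)) F) = b j i)"
proof -
  define ev where "ev = (\<lambda>a m i F. leval \<sigma> \<delta> a (lderiv \<sigma> \<delta> a (take i m) F))"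
  let ?I = "{(j, i). j < length ms \<and> i \<le> length (ms ! j)}"
  have van: "left_van \<sigma> \<delta> = vanishing ev"
    by (intro ext) (simp add: left_van_def vanishing_def ev_def)
  have "right_DP_indep \<sigma> \<delta> pts ms \<longleftrightarrow> (\<forall>(j, i)\<in>?I. \<exists>F. ev (pts ! j) (ms ! j) i F \<noteq> 0 \<and>
      (\<forall>(j', i')\<in>?I. j' \<noteq> j \<or> i' < i \<longrightarrow> ev (pts ! j') (ms ! j') i' F = 0))"
  proof -
    have "right_DP_indep_point \<sigma> \<delta> (remove_nth j pts) (remove_nth j ms) (pts ! j) (ms ! j) \<longleftrightarrow>
       (\<forall>i\<le>length (ms ! j). \<exists>F. ev (pts ! j) (ms ! j) i F \<noteq> 0 \<and> (\<forall>j'<length ms.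
          \<forall>i'\<le>length (ms ! j'). j' \<noteq> j \<or> i' < i \<longrightarrow> ev (pts ! j') (ms ! j') i' F = 0))"
      if j: "j < length ms" for j
    proof -
      have "pts ! j \<notin> set (remove_nth j pts)" using nth_notin_remove_nth dist j len by metis
      then show ?thesis
        using strict_chain_iff_triangular[OF len j, of take ev]
        by (simp add: right_DP_indep_point_def van ev_def min_absorb1)
    qed
    then show ?thesis
      unfolding right_DP_indep_def len ball_positions by (intro all_cong1 imp_cong refl)
  qed
  also have "\<dots> \<longleftrightarrow> (\<forall>b. \<exists>F\<in>polys_less N. \<forall>(j, i)\<in>?I. ev (pts ! j) (ms ! j) i F = b j i)"
    unfolding N
  proof (rule triangular_iff_interpolation)
    show "Modules.additive (ev (pts ! j) (ms ! j) i)" for j i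
      unfolding ev_def by (rule additive_leval_lderiv)
    show "\<exists>G\<in>polys_less d. ev (pts ! j) (ms ! j) i G = c \<and>
        (\<forall>(j', i')\<in>?I. ev (pts ! j') (ms ! j') i' F = 0 \<longrightarrow> ev (pts ! j') (ms ! j') i' G = 0)"
      if "F \<in> polys_less d" "ev (pts ! j) (ms ! j) i F \<noteq> 0" for d F j i c
      by (rule bexI[of _ "skew_mult \<sigma> \<delta> F (const (inverse (ev (pts ! j) (ms ! j) i F) * c))"])
         (use that in \<open>auto simp: ev_def leval_lderiv_mult_const polys_less_mult_const
            mult.assoc[symmetric]\<close>)
    show "\<exists>shift F. Modules.additive shift \<and> F \<in> polys_less (length w) \<and>
        shift F = Poly_Mapping.single w c \<and>
        (\<forall>d G. G \<in> polys_less d \<longrightarrow> shift G \<in> polys_less (Suc d)) \<and>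
        (\<forall>G. (\<forall>(j, i)\<in>?I. ev (pts ! j) (ms ! j) i G = 0) \<longrightarrow>
          (\<forall>(j, i)\<in>?I. ev (pts ! j) (ms ! j) i (shift G) = 0))"
      if nonempty: "w \<noteq> []" for w c
    proof -
      obtain x v where w: "w = v @ [x]" using nonempty by (cases w rule: rev_cases) auto
      show ?thesis
      proof (rule exI[of _ "\<lambda>G. skew_mult \<sigma> \<delta> G (var x)"],
          rule exI[of _ "Poly_Mapping.single v c"], intro conjI allI impI)
        show "Modules.additive (\<lambda>G. skew_mult \<sigma> \<delta> G (var x))"
          by (rule skew_mult_additive[OF hom der])
        show "Poly_Mapping.single v c \<in> polys_less (length w)"
          unfolding w by (rule polys_less_simps) simp
        show "skew_mult \<sigma> \<delta> (Poly_Mapping.single v c) (var x) = Poly_Mapping.single w c"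
          unfolding w by (rule mult_single_var)
        show "skew_mult \<sigma> \<delta> G (var x) \<in> polys_less (Suc d)"
          if "G \<in> polys_less d" for d G using that by (rule polys_less_mult_var)
        show "\<forall>(j, i)\<in>?I. ev (pts ! j) (ms ! j) i (skew_mult \<sigma> \<delta> G (var x)) = 0"
          if "\<forall>(j, i)\<in>?I. ev (pts ! j) (ms ! j) i G = 0" for G
          using that by (auto simp: ev_def intro!: leval_lderiv_mult)
      qed
    qed
  qed
  finally show ?thesis unfolding ball_positions ev_def .
qed

text \<open>
  When the functionals are right linear, the coefficients have to be written to the right of the
  monomials. Surjectivity of \<open>phi\<close> allows to move them there: it solves
  \<open>c x\<^sub>k = (\<Sum>\<^sub>i x\<^sub>i \<gamma>\<^sub>i) + d\<close> for constants \<open>\<gamma>\<^sub>i\<close> and \<open>d\<close>.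
\<close>

lemma polys_less_right_coefficients:
  assumes "F \<in> polys_less d"
  shows "\<exists>z. F = (\<Sum>w\<in>{w. length w < d}. skew_mult \<sigma> \<delta> (monomial w) (const (z w)))"
proof -
  have fin: "finite {w :: 'n list. length w < d}" for d
    using finite_lists_length_le[of "UNIV :: 'n set" d]
    by (rule finite_subset[rotated]) auto
  define S where "S d = {F. \<exists>z. F = (\<Sum>w\<in>{w. length w < d}. skew_mult \<sigma> \<delta> (monomial w) (const (z w)))}"
    for d
  have zero: "0 \<in> S d" for d
    unfolding S_def by (auto intro!: exI[of _ "\<lambda>_. 0"] simp: const_zero mult_zero_right)
  have add: "F + G \<in> S d" if FG: "F \<in> S d" "G \<in> S d" for F G d
  proof -
    obtain y z where "F = (\<Sum>w\<in>{w. length w < d}. skew_mult \<sigma> \<delta> (monomial w) (const (y w)))"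
      "G = (\<Sum>w\<in>{w. length w < d}. skew_mult \<sigma> \<delta> (monomial w) (const (z w)))"
      using FG unfolding S_def by blast
    then show ?thesis unfolding S_def mem_Collect_eq
      by (intro exI[of _ "\<lambda>w. y w + z w"])
         (simp add: const_def single_add mult_add_right sum.distrib)
  qed
  have sum: "(\<Sum>i\<in>A. G i) \<in> S d" if "\<And>i. i \<in> A \<Longrightarrow> G i \<in> S d" for G d and A :: "'b set"
    using that by (induct A rule: infinite_finite_induct) (auto intro: zero add)
  have gen: "skew_mult \<sigma> \<delta> (monomial v) (const c) \<in> S d" if v: "length v < d" for v c d
  proof -
    have "(\<Sum>w\<in>{w. length w < d}. skew_mult \<sigma> \<delta> (monomial w) (const (if w = v then c else 0)))
        = (\<Sum>w\<in>{w. length w < d}. if w = v then skew_mult \<sigma> \<delta> (monomial v) (const c) else 0)"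
      by (rule sum.cong) (auto simp: const_zero mult_zero_right)
    also have "\<dots> = skew_mult \<sigma> \<delta> (monomial v) (const c)" using v by (simp add: fin)
    finally show ?thesis unfolding S_def mem_Collect_eq
      by (intro exI[of _ "\<lambda>w. if w = v then c else 0"]) simp
  qed
  have mono: "F \<in> S e" if F: "F \<in> S d" "d \<le> e" for F d e
  proof -
    obtain z where "F = (\<Sum>w\<in>{w. length w < d}. skew_mult \<sigma> \<delta> (monomial w) (const (z w)))"
      using F unfolding S_def by blast
    then show ?thesis using F(2) by (auto intro!: sum gen)
  qed
  have shift: "var_mult \<sigma> \<delta> i F \<in> S (Suc d)" if F: "F \<in> S d" for i F d
  proof -
    obtain z where z: "F = (\<Sum>w\<in>{w. length w < d}. skew_mult \<sigma> \<delta> (monomial w) (const (z w)))"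
      using F unfolding S_def by blast
    have "skew_mult \<sigma> \<delta> (var i) F =
        (\<Sum>w\<in>{w. length w < d}. skew_mult \<sigma> \<delta> (monomial (i # w)) (const (z w)))"
      unfolding z mult_sum_right mult_assoc[symmetric]
      by (simp add: var_def skew_mult_monomial[OF hom der])
    then show ?thesis
      unfolding skew_mult_var_left[OF hom der] by (auto intro!: sum gen)
  qed
  have single: "Poly_Mapping.single w c \<in> S (Suc (length w))" for w c
  proof (induct w arbitrary: c)
    case Nil
    have "Poly_Mapping.single [] c = skew_mult \<sigma> \<delta> (monomial []) (const c)"
      by (simp add: monomial_def const_def skew_mult_single[OF hom der])
    then show ?case using gen[of "[]" 1 c] by simp
  next
    case (Cons k w)
    obtain \<gamma> where \<gamma>: "phi \<sigma> \<gamma> = (\<chi> j. if j = k then c else 0)" using phi by (metis bij_pointE)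
    have \<gamma>': "(\<Sum>i\<in>UNIV. \<sigma> (\<gamma> $ i) $ i $ j) = (if j = k then c else 0)" for j
      using arg_cong[OF \<gamma>, of "\<lambda>v. v $ j"] by (simp add: phi_def)
    have single_sum: "(\<Sum>i\<in>UNIV. Poly_Mapping.single v (g i)) = Poly_Mapping.single v (\<Sum>i\<in>UNIV. g i)"
      for v :: "'n list" and g :: "'n \<Rightarrow> 'a"
      by (rule poly_mapping_eqI) (simp add: lookup_sum lookup_single when_def)
    have "(\<Sum>i\<in>UNIV. var_mult \<sigma> \<delta> i (Poly_Mapping.single w (\<gamma> $ i)))
        = (\<Sum>j\<in>UNIV. \<Sum>i\<in>UNIV. Poly_Mapping.single (j # w) (\<sigma> (\<gamma> $ i) $ i $ j))
          + (\<Sum>i\<in>UNIV. Poly_Mapping.single w (\<delta> (\<gamma> $ i) $ i))"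
      by (simp add: var_mult_single[OF hom der] sum.distrib) (rule sum.swap)
    also have "(\<Sum>j\<in>UNIV. \<Sum>i\<in>UNIV. Poly_Mapping.single (j # w) (\<sigma> (\<gamma> $ i) $ i $ j))
        = (\<Sum>j\<in>UNIV. if j = k then Poly_Mapping.single (k # w) c else 0)"
      unfolding single_sum \<gamma>' by (rule sum.cong) auto
    also have "\<dots> = Poly_Mapping.single (k # w) c" by simp
    finally have "Poly_Mapping.single (k # w) c =
        (\<Sum>i\<in>UNIV. var_mult \<sigma> \<delta> i (Poly_Mapping.single w (\<gamma> $ i)))
        + (\<Sum>i\<in>UNIV. Poly_Mapping.single w (- (\<delta> (\<gamma> $ i) $ i)))"
      by (simp add: single_uminus sum_negf)
    moreover have "\<dots> \<in> S (Suc (Suc (length w)))"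
      by (intro add sum shift Cons) (rule mono[OF Cons], simp)
    ultimately show ?case by simp
  qed
  from assms have "F \<in> S d"
  proof (induct F rule: polys_less_induct)
    case (single w c)
    then show ?case using mono \<open>\<And>w c. Poly_Mapping.single w c \<in> S (Suc (length w))\<close> by (metis Suc_leI)
  qed (auto intro: zero add)
  then show ?thesis by (simp add: S_def)
qed

end


section \<open>Confluent Vandermonde systems\<close>

lemma polys_less_eq_right_combinations:
  assumes phi: "bij (phi \<sigma>)" and mons: "lists_monomials N mons"
  shows "polys_less N = (\<lambda>z. \<Sum>s<length mons. skew_mult \<sigma> \<delta> (monomial (mons ! s))
     (const (vec_index z s))) ` carrier_vec (length mons)" (is "_ = ?comb ` _")
proof (intro equalityI subsetI)
  fix F :: "('a, 'n) skew_poly" assume "F \<in> polys_less N"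
  from polys_less_right_coefficients[OF phi this] obtain z where
    "F = (\<Sum>w\<in>{w. length w < N}. skew_mult \<sigma> \<delta> (monomial w) (const (z w)))" by blast
  also have "\<dots> = ?comb (Matrix.vec (length mons) (\<lambda>s. z (mons ! s)))"
    unfolding sum_monomials[OF mons] by simp
  finally show "F \<in> ?comb ` carrier_vec (length mons)" by (rule image_eqI) simp
next
  fix F :: "('a, 'n) skew_poly" assume "F \<in> ?comb ` carrier_vec (length mons)"
  then obtain z where F: "F = ?comb z" by blast
  have "monomial (mons ! s) \<in> polys_less N" if "s < length mons" for s
    using mons nth_mem[OF that] by (auto simp: lists_monomials_def monomial_def polys_less_simps)
  then show "F \<in> polys_less N"
    unfolding F by (intro polys_less_sum polys_less_mult_const[OF phi]) simp
qed

lemma right_Vandermonde_solution_iff: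
  assumes "length pts = length ms" "length bs = length ms"
    and bs: "\<forall>j<length ms. bs ! j \<in> carrier_vec (length (ms ! j) + 1)"
    and z: "z \<in> carrier_vec (length mons)"
  shows "mat_of_row z * right_Vandermonde \<sigma> \<delta> mons pts ms = mat_of_row (concat_vec bs) \<longleftrightarrow>
     (\<forall>j<length ms. \<forall>i\<le>length (ms ! j). reval \<sigma> \<delta> (pts ! j) (rderiv \<sigma> \<delta> (pts ! j)
        (suffix_of_len i (ms ! j)) (\<Sum>s<length mons. Poly_Mapping.single (mons ! s) (vec_index z s)))
      = vec_index (bs ! j) i)"
proof -
  define c where "c a m i = Matrix.vec (length mons) (\<lambda>s. reval \<sigma> \<delta> a (rderiv \<sigma> \<delta> a
      (suffix_of_len i m) (monomial (mons ! s))))" for a :: "'a ^ 'n" and m i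
  have block: "cols (right_Vandermonde_block \<sigma> \<delta> mons a m) = map (c a m) [0..<Suc (length m)]" for a m
    by (rule nth_equalityI) (auto simp: right_Vandermonde_block_def c_def simp del: upt_Suc)
  have V: "right_Vandermonde \<sigma> \<delta> mons pts ms =
      mat_of_cols (length mons) (map (\<lambda>(j, i). c (pts ! j) (ms ! j) i) (positions ms))"
    unfolding right_Vandermonde_def concat_map2_positions[OF assms(1) block] ..
  have single: "Poly_Mapping.single w x = lscale x (monomial w)" for w :: "'n list" and x :: 'a
    by (simp add: monomial_def)
  have "scalar_prod z (c a m i) = reval \<sigma> \<delta> a (rderiv \<sigma> \<delta> a (suffix_of_len i m)
      (\<Sum>s<length mons. Poly_Mapping.single (mons ! s) (vec_index z s)))" for a m i
    unfolding additive.sum[OF additive_reval_rderiv] single reval_rderiv_lscale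
    by (simp add: scalar_prod_def c_def atLeast0LessThan)
  then show ?thesis
    unfolding V concat_vec_positions[OF assms(2) bs]
    by (subst mat_of_row_mult_mat_of_cols[OF z])
       (auto simp: set_positions c_def)
qed

lemma left_Vandermonde_solution_iff:
  assumes phi: "bij (phi \<sigma>)" and len: "length pts = length ms" "length bs = length ms"
    and bs: "\<forall>j<length ms. bs ! j \<in> carrier_vec (length (ms ! j) + 1)"
    and z: "z \<in> carrier_vec (length mons)"
  shows "left_Vandermonde \<sigma> \<delta> mons pts ms *\<^sub>v z = concat_vec bs \<longleftrightarrow>
     (\<forall>j<length ms. \<forall>i\<le>length (ms ! j). leval \<sigma> \<delta> (pts ! j) (lderiv \<sigma> \<delta> (pts ! j)
        (take i (ms ! j)) (\<Sum>s<length mons. skew_mult \<sigma> \<delta> (monomial (mons ! s))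
           (const (vec_index z s)))) = vec_index (bs ! j) i)"
proof -
  define c where "c a m i = Matrix.vec (length mons) (\<lambda>s. leval \<sigma> \<delta> a (lderiv \<sigma> \<delta> a
      (take i m) (monomial (mons ! s))))" for a :: "'a ^ 'n" and m i
  have block: "rows (left_Vandermonde_block \<sigma> \<delta> mons a m) = map (c a m) [0..<Suc (length m)]" for a m
    by (rule nth_equalityI) (auto simp: left_Vandermonde_block_def c_def simp del: upt_Suc)
  have V: "left_Vandermonde \<sigma> \<delta> mons pts ms =
      mat_of_rows (length mons) (map (\<lambda>(j, i). c (pts ! j) (ms ! j) i) (positions ms))"
    unfolding left_Vandermonde_def concat_map2_positions[OF len(1) block] ..
  have "scalar_prod (c a m i) z = leval \<sigma> \<delta> a (lderiv \<sigma> \<delta> a (take i m)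
      (\<Sum>s<length mons. skew_mult \<sigma> \<delta> (monomial (mons ! s)) (const (vec_index z s))))" for a m i
    unfolding additive.sum[OF additive_leval_lderiv[OF phi]] leval_lderiv_mult_const[OF phi]
    using z by (simp add: scalar_prod_def c_def atLeast0LessThan)
  then show ?thesis
    unfolding V concat_vec_positions[OF len(2) bs]
    by (subst mat_of_rows_mult_vec[OF z])
       (auto simp: set_positions c_def)
qed

end


section \<open>The equivalences\<close>

theorem corollary3p28:
  fixes \<sigma> :: "'a::division_ring \<Rightarrow> 'a ^ 'n::finite ^ 'n"
    and \<delta> :: "'a \<Rightarrow> 'a ^ 'n"
    and pts :: "('a ^ 'n) list"
    and ms mons :: "'n list list"
    and k N r :: nat
  assumes "ring_hom_mat \<sigma>"
    and "vector_derivation \<sigma> \<delta>"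
    and "k \<ge> 1"
    and "length pts = k"
    and "distinct pts"
    and "length ms = k"
    and "N = (\<Sum>j<k. (length (ms ! j) + 1))"
    and "r = (\<Sum>i<N. CARD('n) ^ i)"
    and "lists_monomials N mons"
  shows
    "((left_DP_indep \<sigma> \<delta> pts ms \<longleftrightarrow>
        (\<forall>b :: nat \<Rightarrow> nat \<Rightarrow> 'a. \<exists>F :: ('a, 'n) skew_poly. deg_poly F < ereal (real N) \<and>
           (\<forall>j<k. \<forall>i\<le>length (ms ! j).
              reval \<sigma> \<delta> (pts ! j) (rderiv \<sigma> \<delta> (pts ! j) (suffix_of_len i (ms ! j)) F) = b j i))) \<and>
      (left_DP_indep \<sigma> \<delta> pts ms \<longleftrightarrow>
        (\<forall>bs :: 'a Matrix.vec list.
           length bs = k \<and> (\<forall>j<k. bs ! j \<in> carrier_vec (length (ms ! j) + 1)) \<longrightarrow>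
           (\<exists>z \<in> carrier_vec r.
              mat_of_row z * right_Vandermonde \<sigma> \<delta> mons pts ms = mat_of_row (concat_vec bs)))))
     \<and>
     (Modules.additive (phi \<sigma>) \<and> bij (phi \<sigma>) \<longrightarrow>
      (right_DP_indep \<sigma> \<delta> pts ms \<longleftrightarrow>
        (\<forall>b :: nat \<Rightarrow> nat \<Rightarrow> 'a. \<exists>F :: ('a, 'n) skew_poly. deg_poly F < ereal (real N) \<and>
           (\<forall>j<k. \<forall>i\<le>length (ms ! j).
              leval \<sigma> \<delta> (pts ! j) (lderiv \<sigma> \<delta> (pts ! j) (take i (ms ! j)) F) = b j i))) \<and>
      (right_DP_indep \<sigma> \<delta> pts ms \<longleftrightarrow>
        (\<forall>bs :: 'a Matrix.vec list.
           length bs = k \<and> (\<forall>j<k. bs ! j \<in> carrier_vec (length (ms ! j) + 1)) \<longrightarrow>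
           (\<exists>z \<in> carrier_vec r.
              left_Vandermonde \<sigma> \<delta> mons pts ms *\<^sub>v z = concat_vec bs))))"
proof -
  note hd = \<open>ring_hom_mat \<sigma>\<close> \<open>vector_derivation \<sigma> \<delta>\<close>
  have len: "length pts = length ms" and ms: "length ms = k" using assms by simp_all
  have N: "N = (\<Sum>j<length ms. length (ms ! j) + 1)" using assms by simp
  have "0 < N" unfolding N using assms by (intro sum_pos) (auto simp: lessThan_empty_iff)
  have mons: "length mons = r" using length_monomials assms by blast
  have deg: "(\<exists>F. deg_poly F < ereal (real N) \<and> P F) \<longleftrightarrow> (\<exists>F\<in>polys_less N. P F)"
    for P :: "('a, 'n) skew_poly \<Rightarrow> bool"
    using deg_poly_less_iff[OF \<open>0 < N\<close>] by blast
  show ?thesis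
    unfolding deg
  proof (intro conjI impI)
    show int: "left_DP_indep \<sigma> \<delta> pts ms \<longleftrightarrow> (\<forall>b. \<exists>F\<in>polys_less N. \<forall>j<k. \<forall>i\<le>length (ms ! j).
        reval \<sigma> \<delta> (pts ! j) (rderiv \<sigma> \<delta> (pts ! j) (suffix_of_len i (ms ! j)) F) = b j i)"
      using left_DP_indep_iff_interpolation[OF hd len \<open>distinct pts\<close> N] unfolding ms .
    show "left_DP_indep \<sigma> \<delta> pts ms \<longleftrightarrow> (\<forall>bs.
        length bs = k \<and> (\<forall>j<k. bs ! j \<in> carrier_vec (length (ms ! j) + 1)) \<longrightarrow>
        (\<exists>z\<in>carrier_vec r.
           mat_of_row z * right_Vandermonde \<sigma> \<delta> mons pts ms = mat_of_row (concat_vec bs)))"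
      unfolding int
    proof (rule interpolation_iff_solvable)
      show "polys_less N =
          (\<lambda>z. \<Sum>s<r. Poly_Mapping.single (mons ! s) (vec_index z s)) ` carrier_vec r"
        using polys_less_eq_left_combinations[OF \<open>lists_monomials N mons\<close>] unfolding mons .
    qed (rule right_Vandermonde_solution_iff[OF hd len, unfolded ms, of _ _ mons, unfolded mons])
  next
    assume "Modules.additive (phi \<sigma>) \<and> bij (phi \<sigma>)"
    then have phi: "bij (phi \<sigma>)" by simp
    show int: "right_DP_indep \<sigma> \<delta> pts ms \<longleftrightarrow> (\<forall>b. \<exists>F\<in>polys_less N. \<forall>j<k. \<forall>i\<le>length (ms ! j).
        leval \<sigma> \<delta> (pts ! j) (lderiv \<sigma> \<delta> (pts ! j) (take i (ms ! j)) F) = b j i)"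
      using right_DP_indep_iff_interpolation[OF hd phi len \<open>distinct pts\<close> N] unfolding ms .
    show "right_DP_indep \<sigma> \<delta> pts ms \<longleftrightarrow> (\<forall>bs.
        length bs = k \<and> (\<forall>j<k. bs ! j \<in> carrier_vec (length (ms ! j) + 1)) \<longrightarrow>
        (\<exists>z\<in>carrier_vec r. left_Vandermonde \<sigma> \<delta> mons pts ms *\<^sub>v z = concat_vec bs))"
      unfolding int
    proof (rule interpolation_iff_solvable)
      show "polys_less N = (\<lambda>z. \<Sum>s<r. skew_mult \<sigma> \<delta> (monomial (mons ! s))
          (const (vec_index z s))) ` carrier_vec r"
        using polys_less_eq_right_combinations[OF hd phi \<open>lists_monomials N mons\<close>] unfolding mons .
    qed (rule left_Vandermonde_solution_iff[OF hd phi len, unfolded ms, of _ _ mons, unfolded mons])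
  qed
qed

end
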